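(* Let $a\in\{p_1,\dotsc,p_n\}$. Given a feasible solution $x$ of mod-IP($a$), the procedure described in the context (started from $x$) constructs a feasible solution to the Multiway Partitioning instance, i.e. a partition $A_1\dot\cup\cdots\dot\cup A_m=\{1,\dotsc,n\}$ with $\sum_{j\in A_i}p_j=T_i$ for all $i=1,\dotsc,m$, in time polynomial in $n$.
   Context: A Multiway Partitioning instance consists of integers $n\ge m\ge1$, $p_1,\dotsc,p_n\in\mathbb{N}$ and $T_1,\dotsc,T_m\in\mathbb{N}$ with $p_1+\cdots+p_n=T_1+\cdots+T_m$ (jobs $j$ with processing times $p_j$, machines $i$ with targets $T_i$). Let $p_{\max}=\max_j p_j$. A machine $i$ is small if $T_i<p_{\max}^4$ and big otherwise; $S$ is the set of small machines and $B=\{1,\dotsc,m\}\setminus S$. For $a\in\{p_1,\dotsc,p_n\}$, mod-IP($a$) is the system in binary variables $x_{ij}\in\{0,1\}$ ($i=1,\dotsc,m$, $j=1,\dotsc,n$): $\sum_j p_jx_{ij}=T_i$ for all $i\in S$; $\sum_j p_jx_{ij}\equiv T_i \pmod a$ for all $i\in B$; $\sum_{j:p_j=a}\sum_{i\in B}x_{ij}\ge p_{\max}^2|B|$; $\sum_{i=1}^m x_{ij}=1$ for all $j$. The load of machine $i$ under a (partial) assignment is the total processing time of jobs assigned to it. The procedure: Phase I: starting from the assignment $x$, remove (make unassigned) every job of processing time $a$ assigned to a big machine; then, as long as there are a big machine $i$ and a value $b\neq a$ such that at least $a$ jobs of processing time $b$ are assigned to $i$, remove $a$ of these jobs from $i$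 together; such a removed group of $a$ jobs is called a bundle. Phase II: the bundles are reassigned greedily one at a time, each bundle's jobs all to a single big machine $i$ whose load after adding the bundle does not exceed $T_i$. Phase III: then the removed jobs of processing time $a$ are reassigned greedily one at a time, each to a big machine $i$ whose load after adding it does not exceed $T_i$. The output is $A_i=$ set of jobs assigned to machine $i$ at the end. *)

theory Defs
  imports "HOL-Number_Theory.Cong" "HOL-Computational_Algebra.Polynomial"
begin

section \<open>Multiway partitioning and the modular integer program\<close>

text \<open>Jobs are \<open>1, \<dots>, n\<close> and machines are \<open>1, \<dots>, m\<close>; the values of \<open>p\<close>, \<open>T\<close> and \<open>x\<close> outside
  these ranges are irrelevant. Processing times and targets may be \<open>0\<close>; only the modulus \<open>a\<close>
  of a modular program has to be positive, since the procedure removes groups of \<open>a\<close> jobs.\<close>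

definition mp_instance :: "nat \<Rightarrow> nat \<Rightarrow> (nat \<Rightarrow> nat) \<Rightarrow> (nat \<Rightarrow> nat) \<Rightarrow> bool" where
  "mp_instance n m p T \<longleftrightarrow> n \<ge> m \<and> m \<ge> 1 \<and> (\<Sum>j=1..n. p j) = (\<Sum>i=1..m. T i)"

definition feasible_partition ::
  "nat \<Rightarrow> nat \<Rightarrow> (nat \<Rightarrow> nat) \<Rightarrow> (nat \<Rightarrow> nat) \<Rightarrow> (nat \<Rightarrow> nat set) \<Rightarrow> bool" where
  "feasible_partition n m p T A \<longleftrightarrow>
     (\<Union>i\<in>{1..m}. A i) = {1..n} \<and>
     (\<forall>i\<in>{1..m}. \<forall>i'\<in>{1..m}. i \<noteq> i' \<longrightarrow> A i \<inter> A i' = {}) \<and>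
     (\<forall>i\<in>{1..m}. (\<Sum>j\<in>A i. p j) = T i)"

definition p_max :: "nat \<Rightarrow> (nat \<Rightarrow> nat) \<Rightarrow> nat" where
  "p_max n p = Max (p ` {1..n})"

definition small_machines :: "nat \<Rightarrow> nat \<Rightarrow> (nat \<Rightarrow> nat) \<Rightarrow> (nat \<Rightarrow> nat) \<Rightarrow> nat set" where
  "small_machines n m p T = {i\<in>{1..m}. T i < p_max n p ^ 4}"

definition big_machines :: "nat \<Rightarrow> nat \<Rightarrow> (nat \<Rightarrow> nat) \<Rightarrow> (nat \<Rightarrow> nat) \<Rightarrow> nat set" where
  "big_machines n m p T = {1..m} - small_machines n m p T"

definition mod_IP_feasible ::
  "nat \<Rightarrow> nat \<Rightarrow> (nat \<Rightarrow> nat) \<Rightarrow> (nat \<Rightarrow> nat) \<Rightarrow> nat \<Rightarrow> (nat \<Rightarrow> nat \<Rightarrow> nat) \<Rightarrow> bool" where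
  "mod_IP_feasible n m p T a x \<longleftrightarrow>
     (\<forall>i\<in>{1..m}. \<forall>j\<in>{1..n}. x i j \<in> {0, 1}) \<and>
     (\<forall>i\<in>small_machines n m p T. (\<Sum>j=1..n. p j * x i j) = T i) \<and>
     (\<forall>i\<in>big_machines n m p T. [(\<Sum>j=1..n. p j * x i j) = T i] (mod a)) \<and>
     (\<Sum>j\<in>{j\<in>{1..n}. p j = a}. \<Sum>i\<in>big_machines n m p T. x i j)
        \<ge> p_max n p ^ 2 * card (big_machines n m p T) \<and>
     (\<forall>j\<in>{1..n}. (\<Sum>i=1..m. x i j) = 1)"


section \<open>A nondeterministic unit-cost RAM language\<close>

text \<open>Running time is the number of small steps, each of which performs one assignment, one test,
  one choice, or pure control flow. A program is a fixed term that does not depend on the input, so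
  its expressions have bounded size and every step costs \<open>O(1)\<close> arithmetic operations,
  comparisons and memory accesses. The only product formed by the procedure below is
  \<open>p_max ^ 4\<close>, so the unit-cost measure is not exploited to build long numbers.\<close>

datatype name =
    NJobs | NMachines | PTime | Target | AVal | XSol  \<comment> \<open>input, never written\<close>
  | Asg                                               \<comment> \<open>machine of a job, \<open>0\<close> if unassigned\<close>
  | PMax | Thresh | RemA | NumA | Bundle | Pend | NumB | Items | NumL | CandM | CandB | NumC
  | Ix | Jx | Kx | Rx | Qx | Mach | Val | Job | Cnt | Wt | Load

text \<open>Every name denotes an array indexed by lists of numbers; scalars live at the index \<open>[]\<close>.\<close>

type_synonym state = "name \<Rightarrow> nat list \<Rightarrow> nat"

datatype aexp =
    Num nat
  | Get name "aexp list"
  | Add aexp aexp (infixl "[+]" 65)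
  | Sub aexp aexp (infixl "[-]" 65)
  | Mul aexp aexp (infixl "[*]" 70)

datatype bexp =
    Less aexp aexp (infix "[<]" 50)
  | Leq aexp aexp (infix "[<=]" 50)
  | Equal aexp aexp (infix "[=]" 50)
  | Neg bexp
  | Conj bexp bexp (infixr "[&]" 35)

abbreviation Var :: "name \<Rightarrow> aexp" where
  "Var v \<equiv> Get v []"

fun aval :: "state \<Rightarrow> aexp \<Rightarrow> nat" where
  "aval s (Num k) = k"
| "aval s (Get v es) = s v (map (aval s) es)"
| "aval s (e [+] f) = aval s e + aval s f"
| "aval s (e [-] f) = aval s e - aval s f"
| "aval s (e [*] f) = aval s e * aval s f"

fun bval :: "state \<Rightarrow> bexp \<Rightarrow> bool" where
  "bval s (e [<] f) \<longleftrightarrow> aval s e < aval s f"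
| "bval s (e [<=] f) \<longleftrightarrow> aval s e \<le> aval s f"
| "bval s (e [=] f) \<longleftrightarrow> aval s e = aval s f"
| "bval s (Neg b) \<longleftrightarrow> \<not> bval s b"
| "bval s (b [&] c) \<longleftrightarrow> bval s b \<and> bval s c"

text \<open>\<open>Pick v e\<close> stores an arbitrary number less than \<open>e\<close> in \<open>v\<close>; it is stuck if \<open>e\<close> evaluates
  to \<open>0\<close>. All choices the procedure leaves open are made by \<open>Pick\<close>.\<close>

datatype com =
    Skip
  | Store name "aexp list" aexp
  | Pick name aexp
  | Seq com com (infixr ";;" 60)
  | Cond bexp com com ("(IF _/ THEN _/ ELSE _)" [0, 0, 61] 61)
  | While bexp com ("(WHILE _/ DO _)" [0, 61] 61)

abbreviation Set_var :: "name \<Rightarrow> aexp \<Rightarrow> com" (infix "[:=]" 62) where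
  "v [:=] e \<equiv> Store v [] e"

abbreviation When :: "bexp \<Rightarrow> com \<Rightarrow> com" ("(WHEN _/ DO _)" [0, 61] 61) where
  "WHEN b DO c \<equiv> IF b THEN c ELSE Skip"

abbreviation For :: "name \<Rightarrow> aexp \<Rightarrow> com \<Rightarrow> com" ("(FOR _/ UPTO _/ DO _)" [0, 0, 61] 61) where
  "FOR v UPTO e DO c \<equiv>
     v [:=] Num 1 ;; WHILE Var v [<=] e DO (c ;; v [:=] Var v [+] Num 1)"

definition upd :: "name \<Rightarrow> nat list \<Rightarrow> nat \<Rightarrow> state \<Rightarrow> state" where
  "upd v ks k s = s(v := (s v)(ks := k))"

inductive step :: "com \<times> state \<Rightarrow> com \<times> state \<Rightarrow> bool" (infix "\<leadsto>" 55) where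
  step_store: "(Store v es e, s) \<leadsto> (Skip, upd v (map (aval s) es) (aval s e) s)"
| step_pick: "r < aval s e \<Longrightarrow> (Pick v e, s) \<leadsto> (Skip, upd v [] r s)"
| step_seq_skip: "(Skip ;; d, s) \<leadsto> (d, s)"
| step_seq: "(c, s) \<leadsto> (c', s') \<Longrightarrow> (c ;; d, s) \<leadsto> (c' ;; d, s')"
| step_if_true: "bval s b \<Longrightarrow> (IF b THEN c ELSE d, s) \<leadsto> (c, s)"
| step_if_false: "\<not> bval s b \<Longrightarrow> (IF b THEN c ELSE d, s) \<leadsto> (d, s)"
| step_while: "(WHILE b DO c, s) \<leadsto> (IF b THEN c ;; WHILE b DO c ELSE Skip, s)"

text \<open>A configuration without successor is either a completed run (\<open>Skip\<close>) or a failed one (a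
  \<open>Pick\<close> from nothing).\<close>

definition final :: "com \<times> state \<Rightarrow> bool" where
  "final cfg \<longleftrightarrow> (\<nexists>cfg'. cfg \<leadsto> cfg')"


section \<open>The procedure\<close>

abbreviation is_big :: "aexp \<Rightarrow> bexp" where
  "is_big e \<equiv> Var Thresh [<=] Get Target [e]"

definition start_assignment :: com where
  "start_assignment =
     PMax [:=] Num 0 ;;
     FOR Jx UPTO Var NJobs DO
       (WHEN Var PMax [<] Get PTime [Var Jx] DO PMax [:=] Get PTime [Var Jx]) ;;
     Thresh [:=] Var PMax [*] Var PMax [*] Var PMax [*] Var PMax ;;
     FOR Ix UPTO Var NMachines DO
       (FOR Jx UPTO Var NJobs DO
         (WHEN Get XSol [Var Ix, Var Jx] [=] Num 1 DO Store Asg [Var Jx] (Var Ix)))"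

text \<open>The removed jobs of processing time \<open>a\<close> are \<open>RemA[0], \<dots>, RemA[NumA - 1]\<close>.\<close>

definition remove_a_jobs :: com where
  "remove_a_jobs =
     NumA [:=] Num 0 ;;
     FOR Jx UPTO Var NJobs DO
       (WHEN Get PTime [Var Jx] [=] Var AVal [&] is_big (Get Asg [Var Jx]) DO
         (Store RemA [Var NumA] (Var Jx) ;;
          NumA [:=] Var NumA [+] Num 1 ;;
          Store Asg [Var Jx] (Num 0)))"

text \<open>List in \<open>(CandM[r], CandB[r])\<close>, \<open>r < NumC\<close>, all pairs of a big machine \<open>i\<close> and a value
  \<open>b \<noteq> a\<close> such that at least \<open>a\<close> jobs of processing time \<open>b\<close> are assigned to \<open>i\<close> (possibly with
  repetitions). For \<open>a > 0\<close> such a \<open>b\<close> is the processing time of some job assigned to \<open>i\<close>.\<close>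

definition find_groups :: com where
  "find_groups =
     NumC [:=] Num 0 ;;
     FOR Ix UPTO Var NMachines DO
       (WHEN is_big (Var Ix) DO
         (FOR Jx UPTO Var NJobs DO
           (WHEN Get Asg [Var Jx] [=] Var Ix [&] Neg (Get PTime [Var Jx] [=] Var AVal) DO
             (Cnt [:=] Num 0 ;;
              FOR Kx UPTO Var NJobs DO
                (WHEN Get Asg [Var Kx] [=] Var Ix [&] Get PTime [Var Kx] [=] Get PTime [Var Jx] DO
                  Cnt [:=] Var Cnt [+] Num 1) ;;
              WHEN Var AVal [<=] Var Cnt DO
                (Store CandM [Var NumC] (Var Ix) ;;
                 Store CandB [Var NumC] (Get PTime [Var Jx]) ;;
                 NumC [:=] Var NumC [+] Num 1)))))"

text \<open>Bundle number \<open>q\<close> consists of the jobs \<open>Bundle[q, 1], \<dots>, Bundle[q, a]\<close>; the bundles still to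
  be reassigned are those numbered \<open>Pend[0], \<dots>, Pend[NumB - 1]\<close>.\<close>

definition remove_bundle :: com where
  "remove_bundle =
     NumL [:=] Num 0 ;;
     FOR Jx UPTO Var NJobs DO
       (WHEN Get Asg [Var Jx] [=] Var Mach [&] Get PTime [Var Jx] [=] Var Val DO
         (Store Items [Var NumL] (Var Jx) ;;
          NumL [:=] Var NumL [+] Num 1)) ;;
     FOR Kx UPTO Var AVal DO
       (Pick Rx (Var NumL) ;;
        Job [:=] Get Items [Var Rx] ;;
        NumL [:=] Var NumL [-] Num 1 ;;
        Store Items [Var Rx] (Get Items [Var NumL]) ;;
        Store Asg [Var Job] (Num 0) ;;
        Store Bundle [Var NumB, Var Kx] (Var Job)) ;;
     Store Pend [Var NumB] (Var NumB) ;;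
     NumB [:=] Var NumB [+] Num 1"

definition phase_I :: com where
  "phase_I =
     remove_a_jobs ;;
     NumB [:=] Num 0 ;;
     find_groups ;;
     WHILE Num 0 [<] Var NumC DO
       (Pick Rx (Var NumC) ;;
        Mach [:=] Get CandM [Var Rx] ;;
        Val [:=] Get CandB [Var Rx] ;;
        remove_bundle ;;
        find_groups)"

text \<open>Choose a big machine whose load does not exceed its target after adding \<open>Wt\<close>; this is stuck
  if there is none.\<close>

definition choose_machine :: com where
  "choose_machine =
     NumC [:=] Num 0 ;;
     FOR Ix UPTO Var NMachines DO
       (WHEN is_big (Var Ix) DO
         (Load [:=] Num 0 ;;
          FOR Jx UPTO Var NJobs DO
            (WHEN Get Asg [Var Jx] [=] Var Ix DO Load [:=] Var Load [+] Get PTime [Var Jx]) ;;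
          WHEN Var Load [+] Var Wt [<=] Get Target [Var Ix] DO
            (Store CandM [Var NumC] (Var Ix) ;;
             NumC [:=] Var NumC [+] Num 1))) ;;
     Pick Rx (Var NumC) ;;
     Mach [:=] Get CandM [Var Rx]"

definition phase_II :: com where
  "phase_II =
     WHILE Num 0 [<] Var NumB DO
       (Pick Rx (Var NumB) ;;
        Qx [:=] Get Pend [Var Rx] ;;
        NumB [:=] Var NumB [-] Num 1 ;;
        Store Pend [Var Rx] (Get Pend [Var NumB]) ;;
        Wt [:=] Num 0 ;;
        FOR Kx UPTO Var AVal DO (Wt [:=] Var Wt [+] Get PTime [Get Bundle [Var Qx, Var Kx]]) ;;
        choose_machine ;;
        FOR Kx UPTO Var AVal DO (Store Asg [Get Bundle [Var Qx, Var Kx]] (Var Mach)))"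

definition phase_III :: com where
  "phase_III =
     WHILE Num 0 [<] Var NumA DO
       (Pick Rx (Var NumA) ;;
        Job [:=] Get RemA [Var Rx] ;;
        NumA [:=] Var NumA [-] Num 1 ;;
        Store RemA [Var Rx] (Get RemA [Var NumA]) ;;
        Wt [:=] Get PTime [Var Job] ;;
        choose_machine ;;
        Store Asg [Var Job] (Var Mach))"

definition procedure :: com where
  "procedure = start_assignment ;; phase_I ;; phase_II ;; phase_III"

definition input_state ::
  "nat \<Rightarrow> nat \<Rightarrow> (nat \<Rightarrow> nat) \<Rightarrow> (nat \<Rightarrow> nat) \<Rightarrow> nat \<Rightarrow> (nat \<Rightarrow> nat \<Rightarrow> nat) \<Rightarrow> state" where
  "input_state n m p T a x = (\<lambda>v ks.
     case (v, ks) of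
       (NJobs, []) \<Rightarrow> n
     | (NMachines, []) \<Rightarrow> m
     | (PTime, [j]) \<Rightarrow> p j
     | (Target, [i]) \<Rightarrow> T i
     | (AVal, []) \<Rightarrow> a
     | (XSol, [i, j]) \<Rightarrow> x i j
     | _ \<Rightarrow> 0)"

definition job_sets :: "nat \<Rightarrow> state \<Rightarrow> nat \<Rightarrow> nat set" where
  "job_sets n s i = {j\<in>{1..n}. s Asg [j] = i}"

end

theory Submission
  imports Defs "HOL-Library.Disjoint_Sets"
begin

text \<open>Moving a bundle or a job of processing time \<open>a\<close> changes a load by a multiple of \<open>a\<close>, so the
  loads of big machines stay congruent to their targets modulo \<open>a\<close>. As long as a bundle is pending, at
  least \<open>p_max\<^sup>2 |B|\<close> jobs of processing time \<open>a\<close> are unassigned, so on average a big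
  machine lacks at least \<open>p_max\<^sup>2\<close>, which is an upper bound for the weight of a bundle; hence
  one of them can take the bundle. Phase I leaves a load of at most
  \<open>p_max\<^sup>3 \<le> p_max\<^sup>4\<close> on each big machine, so no target is ever exceeded. In
  Phase III the slacks are multiples of \<open>a\<close>, so a machine with positive slack has room for another
  job of processing time \<open>a\<close>, and at the end all slacks vanish because they sum to \<open>0\<close>.

  For the running time it suffices that no loop of the procedure makes more than \<open>n\<close> iterations
  each time it is entered: then the number of steps is bounded by a polynomial that can be read off
  the program text.\<close>

subsection \<open>Weakest preconditions with a bound on loop iterations\<close>

text \<open>The choices are unresolved, so every run has to be covered: a \<open>Pick\<close> is
  accepted only if its range is nonempty, and each of its outcomes must lead to the goal.
  Correctness, absence of stuck runs and the time bound thus come from one predicate.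

  The bound of \<open>n\<close> iterations is not purely syntactic, because \<open>a\<close> is a
  number and not a count of objects. The loops running up to \<open>a\<close> are entered only when
  a bundle, or a group from which one is drawn, is at hand; this exhibits \<open>a\<close> distinct
  jobs, so \<open>a\<close> \<le> \<open>n\<close>. The pending bundles number at most
  \<open>n\<close> since they are disjoint and, by \<open>a > 0\<close>, nonempty.

  The bound \<open>p_max ^ 3\<close> counts, for each of \<open>p_max\<close> positive values, fewer
  than \<open>a\<close> \<le> \<open>p_max\<close> jobs of time at most \<open>p_max\<close>. It is
  available only at the end of Phase I; until then big machines may exceed their targets, and only
  exact small loads and congruent big loads are invariant. The averaging argument lasts through
  Phase II because only bundles move there, so the stock of removed jobs of time \<open>a\<close>
  keeps its size.\<close>

primrec cost :: "nat \<Rightarrow> com \<Rightarrow> nat" where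
  "cost n Skip = 0"
| "cost n (Store v es e) = 1"
| "cost n (Pick v e) = 1"
| "cost n (c ;; d) = cost n c + cost n d + 1"
| "cost n (IF b THEN c ELSE d) = cost n c + cost n d + 1"
| "cost n (WHILE b DO c) = n * (cost n c + 3) + 2"

text \<open>The index is an iteration budget. An exhausted budget with a true test yields falsity,
  so a proof about \<open>loop\<close> is also a proof that the budget suffices.\<close>

primrec loop :: "(state \<Rightarrow> bool) \<Rightarrow> ((state \<Rightarrow> bool) \<Rightarrow> state \<Rightarrow> bool) \<Rightarrow> (state \<Rightarrow> bool) \<Rightarrow>
    nat \<Rightarrow> state \<Rightarrow> bool" where
  "loop b F Q 0 = (\<lambda>s. \<not> b s \<and> Q s)"
| "loop b F Q (Suc k) = (\<lambda>s. if b s then F (loop b F Q k) s else Q s)"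

text \<open>Every loop may run for at most \<open>n\<close> iterations each time it is entered, which is what bounds
  the running time by \<open>cost n c\<close>.\<close>

primrec wp :: "nat \<Rightarrow> com \<Rightarrow> (state \<Rightarrow> bool) \<Rightarrow> state \<Rightarrow> bool" where
  "wp n Skip Q = Q"
| "wp n (Store v es e) Q = (\<lambda>s. Q (upd v (map (aval s) es) (aval s e) s))"
| "wp n (Pick v e) Q = (\<lambda>s. 0 < aval s e \<and> (\<forall>r<aval s e. Q (upd v [] r s)))"
| "wp n (c ;; d) Q = wp n c (wp n d Q)"
| "wp n (IF b THEN c ELSE d) Q = (\<lambda>s. if bval s b then wp n c Q s else wp n d Q s)"
| wp_While: "wp n (WHILE b DO c) Q = loop (\<lambda>s. bval s b) (wp n c) Q n"

declare wp_While [simp del]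

lemmas wp_simps = wp.simps(1-5)

text \<open>The program is a fixed term and \<open>n\<close> the only parameter, so each loop
  contributes a factor \<open>[:0, 1:]\<close>; the degree is bounded by the nesting depth of the
  loops.\<close>

lemma cost_poly: "\<exists>q :: nat poly. \<forall>n. cost n c = poly q n"
proof (induction c)
  case (Seq c d)
  then obtain q r where "\<forall>n. cost n c = poly q n" "\<forall>n. cost n d = poly r n" by blast
  then show ?case by (intro exI [of _ "q + r + 1"]) simp
next
  case (Cond b c d)
  then obtain q r where "\<forall>n. cost n c = poly q n" "\<forall>n. cost n d = poly r n" by blast
  then show ?case by (intro exI [of _ "q + r + 1"]) simp
next
  case (While b c)
  then obtain q where "\<forall>n. cost n c = poly q n" by blast
  then show ?case by (intro exI [of _ "[:0, 1:] * (q + [:3:]) + [:2:]"]) simp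
qed (auto intro: exI [of _ "0"] exI [of _ "1"])

text \<open>Must-termination with a step budget. Without the premise that some successor exists, a
  stuck \<open>Pick\<close> would satisfy the universal premise vacuously.\<close>

inductive runs_ok :: "(state \<Rightarrow> bool) \<Rightarrow> nat \<Rightarrow> com \<times> state \<Rightarrow> bool" for Q where
  runs_ok_Skip: "Q s \<Longrightarrow> runs_ok Q N (Skip, s)"
| runs_ok_step: "\<exists>cfg'. cfg \<leadsto> cfg' \<Longrightarrow> \<forall>cfg'. cfg \<leadsto> cfg' \<longrightarrow> runs_ok Q N cfg' \<Longrightarrow> runs_ok Q (Suc N) cfg"

inductive_cases step_SkipE [elim!]: "(Skip, s) \<leadsto> cfg"
inductive_cases step_StoreE [elim!]: "(Store v es e, s) \<leadsto> cfg"
inductive_cases step_PickE [elim!]: "(Pick v e, s) \<leadsto> cfg"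
inductive_cases step_SeqE: "(c ;; d, s) \<leadsto> cfg"
inductive_cases step_CondE [elim!]: "(IF b THEN c ELSE d, s) \<leadsto> cfg"
inductive_cases step_WhileE [elim!]: "(WHILE b DO c, s) \<leadsto> cfg"

text \<open>Each step uses up one layer of the derivation. The bound holds for every prefix of a
  run, finished or not, and so excludes infinite runs as well.\<close>

lemma runs_ok_sound:
  assumes "runs_ok Q N cfg" "(step ^^ t) cfg (c, s)"
  shows "t \<le> N \<and> (final (c, s) \<longrightarrow> c = Skip \<and> Q s)"
  using assms
proof (induction arbitrary: t)
  case (runs_ok_Skip s' N)
  show ?case
  proof (cases t)
    case 0
    then show ?thesis using runs_ok_Skip by simp
  next
    case (Suc u)
    then obtain cfg' where "(Skip, s') \<leadsto> cfg'"
      using runs_ok_Skip.prems by (metis relpowp_Suc_D2)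
    then show ?thesis by blast
  qed
next
  case (runs_ok_step cfg N)
  show ?case
  proof (cases t)
    case 0
    then show ?thesis using runs_ok_step by (auto simp: final_def)
  next
    case (Suc u)
    then obtain cfg' where "cfg \<leadsto> cfg'" "(step ^^ u) cfg' (c, s)"
      using runs_ok_step.prems by (metis relpowp_Suc_D2)
    then have "u \<le> N \<and> (final (c, s) \<longrightarrow> c = Skip \<and> Q s)" using runs_ok_step.IH by blast
    then show ?thesis using Suc by simp
  qed
qed

lemma runs_ok_mono: "runs_ok Q N cfg \<Longrightarrow> N \<le> M \<Longrightarrow> runs_ok Q M cfg"
proof (induction arbitrary: M rule: runs_ok.induct)
  case (runs_ok_step cfg N)
  then obtain M' where "M = Suc M'" "N \<le> M'" by (cases M) auto
  then show ?case using runs_ok_step by (auto intro!: runs_ok.runs_ok_step)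
qed (rule runs_ok.intros)

lemma runs_ok_Seq:
  assumes "runs_ok P N cfg" "cfg = (c, s)" "\<And>s'. P s' \<Longrightarrow> runs_ok Q K (d, s')"
  shows "runs_ok Q (N + K + 1) (c ;; d, s)"
  using assms(1,2)
proof (induction arbitrary: c s rule: runs_ok.induct)
  case (runs_ok_Skip s' N)
  then have "runs_ok Q (Suc K) (c ;; d, s)"
    by (auto intro!: runs_ok_step assms(3) elim!: step_SeqE intro: step_seq_skip)
  then show ?case by (rule runs_ok_mono) simp
next
  case (runs_ok_step cfg N)
  then obtain c1 s1 where 1: "(c, s) \<leadsto> (c1, s1)" by auto
  \<comment> \<open>This rules out \<open>step_seq_skip\<close>, so every step of the sequence is a
    step of its first part.\<close>
  then have "c \<noteq> Skip" by auto
  then have "runs_ok Q (Suc (N + K + 1)) (c ;; d, s)"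
    using runs_ok_step 1
    by (intro runs_ok.runs_ok_step) (auto elim!: step_SeqE intro: step_seq)
  then show ?case by simp
qed

lemma wp_sound: "wp n c Q s \<Longrightarrow> runs_ok Q (cost n c) (c, s)"
proof (induction c arbitrary: Q s)
  case Skip
  then show ?case by (auto intro: runs_ok.intros)
next
  case (Store v es e)
  then show ?case by (auto intro!: runs_ok_step [where N = 0] runs_ok_Skip intro: step_store)
next
  case (Pick v e)
  then show ?case by (auto intro!: runs_ok_step [where N = 0] runs_ok_Skip intro: step_pick)
next
  case (Seq c d)
  show ?case unfolding cost.simps
    by (rule runs_ok_Seq [OF _ refl, where P = "wp n d Q"]) (use Seq in auto)
next
  case (Cond b c d)
  show ?case
  proof (cases "bval s b")
    case True
    then have "runs_ok Q (cost n c + cost n d) (c, s)"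
      using Cond.prems by (intro runs_ok_mono [OF Cond.IH(1)]) auto
    then show ?thesis using True by (auto intro!: runs_ok_step intro: step_if_true)
  next
    case False
    then have "runs_ok Q (cost n c + cost n d) (d, s)"
      using Cond.prems by (intro runs_ok_mono [OF Cond.IH(2)]) auto
    then show ?thesis using False by (auto intro!: runs_ok_step intro: step_if_false)
  qed
next
  case (While b c)
  \<comment> \<open>Unfolding the loop and evaluating its test take two steps, which is the final 2
    in \<open>cost\<close>. A further round pays these two and one more for discarding the
    \<open>Skip\<close> left by the body, hence the 3.\<close>
  have exit: "runs_ok Q (Suc (Suc N)) (WHILE b DO c, s)" if "\<not> bval s b" "Q s" for N s
    using that
    by (auto intro!: runs_ok_step runs_ok_Skip intro: step_while step_if_false)
  have unrolled: "runs_ok Q (Suc (Suc N)) (WHILE b DO c, s)"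
    if run: "runs_ok Q N (c ;; WHILE b DO c, s)" and b: "bval s b" for N s
  proof (rule runs_ok_step)
    have "runs_ok Q (Suc N) (IF b THEN c ;; WHILE b DO c ELSE Skip, s)"
      by (rule runs_ok_step) (use run b in \<open>blast intro: step_if_true\<close>)+
    then show "\<forall>cfg'. (WHILE b DO c, s) \<leadsto> cfg' \<longrightarrow> runs_ok Q (Suc N) cfg'" by blast
  qed (blast intro: step_while)
  \<comment> \<open>The induction is on the remaining budget \<open>k\<close> alone;
    \<open>n\<close> stays fixed, since inner loops receive the full budget each time they are
    entered.\<close>
  have "loop (\<lambda>s. bval s b) (wp n c) Q k s \<Longrightarrow>
    runs_ok Q (k * (cost n c + 3) + 2) (WHILE b DO c, s)" for k s
  proof (induction k arbitrary: s)
    case 0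
    then show ?case using exit [of s 0] by (simp add: numeral_2_eq_2)
  next
    case (Suc k)
    show ?case
    proof (cases "bval s b")
      case True
      then have "wp n c (loop (\<lambda>s. bval s b) (wp n c) Q k) s" using Suc.prems by simp
      then have "runs_ok Q (cost n c + (k * (cost n c + 3) + 2) + 1) (c ;; WHILE b DO c, s)"
        by (intro runs_ok_Seq [OF While.IH refl] Suc.IH)
      then have "runs_ok Q (Suc (Suc (cost n c + (k * (cost n c + 3) + 2) + 1))) (WHILE b DO c, s)"
        using True unrolled by blast
      then show ?thesis by (rule runs_ok_mono) simp
    next
      case False
      then show ?thesis
        using Suc.prems exit [of s "Suc k * (cost n c + 3)"] False by (simp del: mult_Suc)
    qed
  qed
  then show ?case using While.prems by (simp add: wp_While)
qed

lemma loop_mono: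
  assumes "\<And>P Q s. (\<And>s'. P s' \<Longrightarrow> Q s') \<Longrightarrow> F P s \<Longrightarrow> F Q s"
  shows "(\<And>s'. P s' \<Longrightarrow> Q s') \<Longrightarrow> loop b F P k s \<Longrightarrow> loop b F Q k s"
  by (induction k arbitrary: s) (auto split: if_splits elim!: assms [rotated])

lemma wp_mono: "wp n c P s \<Longrightarrow> (\<And>s'. P s' \<Longrightarrow> Q s') \<Longrightarrow> wp n c Q s"
proof (induction c arbitrary: P Q s)
  case (Seq c d)
  show ?case unfolding wp.simps
    by (rule Seq.IH(1) [where P = "wp n d P"]) (use Seq in auto)
next
  case (While b c)
  then show ?case unfolding wp_While by (elim loop_mono [rotated -1]) blast+
qed (auto split: if_splits)

section \<open>Frame conditions and invariant rules for loops\<close>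

primrec mods :: "com \<Rightarrow> name set" where
  "mods Skip = {}"
| "mods (Store v es e) = {v}"
| "mods (Pick v e) = {v}"
| "mods (c ;; d) = mods c \<union> mods d"
| "mods (IF b THEN c ELSE d) = mods c \<union> mods d"
| "mods (WHILE b DO c) = mods c"

definition agree :: "name set \<Rightarrow> state \<Rightarrow> state \<Rightarrow> bool" where
  "agree X s t \<longleftrightarrow> (\<forall>v. v \<notin> X \<longrightarrow> s v = t v)"

lemma agreeD: "agree X s t \<Longrightarrow> v \<notin> X \<Longrightarrow> s v = t v"
  by (simp add: agree_def)

lemma agree_refl [simp]: "agree X s s"
  by (simp add: agree_def)

lemma agree_trans: "agree X s t \<Longrightarrow> agree Y t u \<Longrightarrow> X \<union> Y \<subseteq> Z \<Longrightarrow> agree Z s u"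
  unfolding agree_def by (metis UnI1 UnI2 subsetD)

lemma upd_apply: "upd v ks k s w = (if w = v then (s v)(ks := k) else s w)"
  by (simp add: upd_def)

text \<open>Frees the invariants from listing the input and everything else that a command does not
  write: such facts are recovered from \<open>agree\<close>.\<close>

lemma wp_frame: "wp n c Q s \<Longrightarrow> wp n c (\<lambda>s'. Q s' \<and> agree (mods c) s' s) s"
proof (induction c arbitrary: Q s)
  case (Seq c d)
  have "wp n c (\<lambda>s'. wp n d Q s' \<and> agree (mods c) s' s) s" using Seq by simp
  then have "wp n c (wp n d (\<lambda>s'. Q s' \<and> agree (mods c \<union> mods d) s' s)) s"
  proof (rule wp_mono)
    fix s' assume "wp n d Q s' \<and> agree (mods c) s' s"
    then have "wp n d (\<lambda>u. Q u \<and> agree (mods d) u s') s'" "agree (mods c) s' s"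
      using Seq.IH(2) by auto
    then show "wp n d (\<lambda>u. Q u \<and> agree (mods c \<union> mods d) u s) s'"
      by (elim wp_mono) (auto elim: agree_trans)
  qed
  then show ?case by simp
next
  case (Cond b c d)
  then show ?case
    by (cases "bval s b") (auto elim!: wp_mono [OF Cond.IH(1)] wp_mono [OF Cond.IH(2)] simp: agree_def)
next
  case (While b c)
  let ?L = "loop (\<lambda>s. bval s b) (wp n c)"
  have "?L Q k s \<Longrightarrow> ?L (\<lambda>s'. Q s' \<and> agree (mods c) s' s) k s" for k s
  proof (induction k arbitrary: s)
    case (Suc k)
    show ?case
    proof (cases "bval s b")
      case True
      then have "wp n c (\<lambda>s'. ?L Q k s' \<and> agree (mods c) s' s) s"
        using Suc.prems While.IH by simp
      then have "wp n c (?L (\<lambda>s'. Q s' \<and> agree (mods c) s' s) k) s"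
      proof (rule wp_mono)
        fix s' assume s': "?L Q k s' \<and> agree (mods c) s' s"
        then have "?L (\<lambda>u. Q u \<and> agree (mods c) u s') k s'" using Suc.IH by blast
        then show "?L (\<lambda>u. Q u \<and> agree (mods c) u s) k s'"
          by (rule loop_mono [rotated -1]) (use s' in \<open>auto elim: wp_mono agree_trans\<close>)
      qed
      then show ?thesis using True by simp
    qed (use Suc.prems in simp)
  qed simp
  then show ?case using While.prems by (simp add: wp_While)
qed (auto simp: agree_def upd_apply)

lemma wp_conseq:
  assumes "wp n c P s" "\<And>s'. P s' \<Longrightarrow> agree (mods c) s' s \<Longrightarrow> Q s'"
  shows "wp n c Q s"
  using wp_frame [OF assms(1)] assms(2) by (rule wp_mono) auto

text \<open>Positivity of the variant under a true test makes a budget of \<open>n\<close> exact: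
  when the budget is used up the variant is \<open>0\<close>, so the test has to fail.\<close>

lemma wp_while:
  assumes init: "I s0" "\<mu> s0 \<le> n"
    and body: "\<And>s. I s \<Longrightarrow> bval s b \<Longrightarrow> agree (mods c) s s0 \<Longrightarrow>
      0 < \<mu> s \<and> wp n c (\<lambda>s'. I s' \<and> \<mu> s' < \<mu> s) s"
    and exit: "\<And>s. I s \<Longrightarrow> \<not> bval s b \<Longrightarrow> agree (mods c) s s0 \<Longrightarrow> Q s"
  shows "wp n (WHILE b DO c) Q s0"
proof -
  have "loop (\<lambda>s. bval s b) (wp n c) Q k s"
    if "I s" "agree (mods c) s s0" "\<mu> s \<le> k" for k s
    using that
  proof (induction k arbitrary: s)
    case 0
    then show ?case using body [of s] exit [of s] by auto
  next
    case (Suc k)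
    show ?case
    proof (cases "bval s b")
      case True
      have "wp n c (\<lambda>s'. I s' \<and> \<mu> s' < \<mu> s) s" using body Suc.prems True by blast
      then have "wp n c (loop (\<lambda>s. bval s b) (wp n c) Q k) s"
        using Suc.prems by (elim wp_conseq) (auto intro!: Suc.IH elim: agree_trans)
      then show ?thesis using True by simp
    qed (use Suc.prems exit in auto)
  qed
  then show ?thesis using init by (simp add: wp_While)
qed

text \<open>The invariant \<open>J k\<close> holds after \<open>k\<close> rounds and must not depend on the counter \<open>v\<close>; variables
  that the body leaves alone need not be mentioned in it.\<close>

lemma wp_for:
  assumes start: "s0 v [] = 1" and le: "K \<le> n" and v: "v \<notin> mods c"
    and e: "\<And>s. agree (insert v (mods c)) s s0 \<Longrightarrow> aval s e = K"
    and stable: "\<And>k s r. J k s \<Longrightarrow> J k (upd v [] r s)"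
    and init: "J 0 s0"
    and body: "\<And>k s. k < K \<Longrightarrow> J k s \<Longrightarrow> s v [] = Suc k \<Longrightarrow>
      agree (insert v (mods c)) s s0 \<Longrightarrow> wp n c (J (Suc k)) s"
    and exit: "\<And>s. J K s \<Longrightarrow> agree (insert v (mods c)) s s0 \<Longrightarrow> Q s"
  shows "wp n (WHILE Var v [<=] e DO (c ;; v [:=] Var v [+] Num 1)) Q s0"
proof -
  let ?A = "\<lambda>s. agree (insert v (mods c)) s s0"
  \<comment> \<open>The counter is one ahead of the \<open>k\<close> completed rounds, so
    \<open>Suc K\<close> minus the counter is the number of rounds left, which is \<open>K\<close>
    at the start.\<close>
  let ?I = "\<lambda>s. \<exists>k\<le>K. s v [] = Suc k \<and> J k s \<and> ?A s"
  show ?thesis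
  proof (rule wp_while [where I = ?I and \<mu> = "\<lambda>s. Suc K - s v []"])
    show "?I s0" using start init by auto
    show "Suc K - s0 v [] \<le> n" using start le by simp
  next
    fix s assume "?I s" and "bval s (Var v [<=] e)"
    then obtain k where k: "k < K" "s v [] = Suc k" "J k s" "?A s" using e [of s] by auto
    have "wp n c (\<lambda>s'. J (Suc k) s' \<and> agree (mods c) s' s) s"
      using body k by (intro wp_frame) auto
    then have "wp n (c ;; v [:=] Var v [+] Num 1) (\<lambda>s'. ?I s' \<and> Suc K - s' v [] < Suc K - s v []) s"
      unfolding wp.simps
    proof (rule wp_mono)
      fix s' assume s': "J (Suc k) s' \<and> agree (mods c) s' s"
      then have "s' v = s v" using v by (auto dest: agreeD)
      moreover have "?A s'" using s' k by (auto intro: agree_trans)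
      ultimately show "?I (upd v (map (aval s') []) (aval s' (Var v [+] Num 1)) s') \<and>
          Suc K - upd v (map (aval s') []) (aval s' (Var v [+] Num 1)) s' v [] < Suc K - s v []"
        using k s' stable by (auto simp: upd_apply agree_def)
    qed
    then show "0 < Suc K - s v [] \<and>
        wp n (c ;; v [:=] Var v [+] Num 1) (\<lambda>s'. ?I s' \<and> Suc K - s' v [] < Suc K - s v []) s"
      using k by auto
  next
    fix s assume "?I s" "\<not> bval s (Var v [<=] e)"
    then obtain k where k: "k \<le> K" "s v [] = Suc k" "J k s" "?A s" "\<not> Suc k \<le> K"
      using e [of s] by auto
    then show "Q s" using exit [of s] by (metis Suc_leI le_neq_implies_less)
  qed
qed

lemma upd_same: "upd v ks k s v = (s v)(ks := k)"
  and upd_other: "w \<noteq> v \<Longrightarrow> upd v ks k s w = s w"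
  by (simp_all add: upd_def)

lemma agree_upd: "v \<in> X \<Longrightarrow> agree X t (upd v ks k s) = agree X t s"
  by (auto simp: agree_def upd_def)

lemmas upd_simps = upd_same upd_other agree_upd

subsection \<open>Arrays used as stacks\<close>

text \<open>The order of the entries is forgotten because they are picked arbitrarily. Injectivity
  makes \<open>N\<close> the number of elements and lets the deletion of one entry delete one
  element.\<close>

definition stack :: "(nat \<Rightarrow> 'b) \<Rightarrow> nat \<Rightarrow> 'b set \<Rightarrow> bool" where
  "stack V N X \<longleftrightarrow> inj_on V {..<N} \<and> V ` {..<N} = X"

lemma stack_empty: "stack V 0 {}"
  by (simp add: stack_def)

lemma stack_push:
  assumes "stack V N X" "y \<notin> X"
  shows "stack (\<lambda>r. if r = N then y else V r) (Suc N) (insert y X)"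
  using assms unfolding stack_def inj_on_def by (auto simp: lessThan_Suc)

text \<open>Deletion in constant time: the last entry overwrites the chosen one. If the chosen entry
  is itself the last, shortening the array already removes it.\<close>

lemma stack_take:
  assumes V: "stack V N X" and r: "r < N"
  shows "V r \<in> X" "stack (\<lambda>r'. if r' = r then V (N - Suc 0) else V r') (N - Suc 0) (X - {V r})"
proof -
  show "V r \<in> X" using assms by (auto simp: stack_def)
  obtain M where M: "N = Suc M" using r by (cases N) auto
  have inj: "\<And>k l. k \<le> M \<Longrightarrow> l \<le> M \<Longrightarrow> V k = V l \<longleftrightarrow> k = l" and X: "X = V ` {..M}"
    using V M by (auto simp: stack_def inj_on_def lessThan_Suc_atMost)
  let ?W = "\<lambda>r'. if r' = r then V M else V r'"
  have "inj_on ?W {..<M}" unfolding inj_on_def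
    using r M by (auto simp: inj split: if_splits)
  moreover have "?W ` {..<M} = X - {V r}"
  proof
    show "?W ` {..<M} \<subseteq> X - {V r}" using r M by (auto simp: X inj)
    show "X - {V r} \<subseteq> ?W ` {..<M}"
    proof
      fix y assume "y \<in> X - {V r}"
      then obtain k where k: "k \<le> M" "y = V k" "k \<noteq> r" by (auto simp: X)
      show "y \<in> ?W ` {..<M}"
      proof (cases "k = M")
        case True
        then have "r < M" "y = ?W r" using k r M by auto
        then show ?thesis by blast
      next
        case False
        then have "k < M" "y = ?W k" using k by auto
        then show ?thesis by blast
      qed
    qed
  qed
  ultimately show "stack (\<lambda>r'. if r' = r then V (N - Suc 0) else V r') (N - Suc 0) (X - {V r})"
    unfolding stack_def M diff_Suc_Suc diff_zero by blast
qed

lemma stack_card: "stack V N X \<Longrightarrow> card X = N"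
  by (auto simp: stack_def card_image)

lemma card_filter_Suc:
  "card {j \<in> {1..Suc k}. P j} = card {j \<in> {1..k}. P j} + (if P (Suc k) then 1 else 0)"
proof -
  have "{j \<in> {1..Suc k}. P j} = (if P (Suc k) then insert (Suc k) else id) {j \<in> {1..k}. P j}"
    by (auto simp: le_Suc_eq)
  then show ?thesis by simp
qed

lemma sum_filter_Suc:
  "(\<Sum>j\<in>{j \<in> {1..Suc k}. P j}. g j) =
    (\<Sum>j\<in>{j \<in> {1..k}. P j}. g j) + (if P (Suc k) then g (Suc k) else (0 :: nat))"
proof -
  have "{j \<in> {1..Suc k}. P j} = (if P (Suc k) then insert (Suc k) else id) {j \<in> {1..k}. P j}"
    by (auto simp: le_Suc_eq)
  then show ?thesis by simp
qed

lemma bij_betw_extend: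
  assumes "bij_betw g {1..k} X" "y \<notin> X"
  shows "bij_betw (\<lambda>l. if l = Suc k then y else g l) {1..Suc k} (insert y X)"
proof -
  have "{1..Suc k} = insert (Suc k) {1..k}" by auto
  moreover have "bij_betw (\<lambda>l. if l = Suc k then y else g l) {1..k} X"
    using assms(1) by (rule bij_betw_cong [THEN iffD1, rotated]) auto
  ultimately show ?thesis
    using notIn_Un_bij_betw [of "Suc k" "{1..k}" "\<lambda>l. if l = Suc k then y else g l" X] assms(2)
    by simp
qed

lemma disjoint_family_on_extend:
  assumes "disjoint_family_on F P" "\<And>q'. q' \<in> P \<Longrightarrow> G q' = F q'"
    "\<And>q'. q' \<in> P \<Longrightarrow> G q \<inter> F q' = {}"
  shows "disjoint_family_on G (insert q P)"
  using assms unfolding disjoint_family_on_def by blast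

subsection \<open>Loads of assignments\<close>

lemma sum_const_card: "(\<And>j. j \<in> X \<Longrightarrow> p j = (b :: nat)) \<Longrightarrow> sum p X = card X * b"
  by simp

locale mod_solution =
  fixes n m :: nat and p T :: "nat \<Rightarrow> nat" and a :: nat and x :: "nat \<Rightarrow> nat \<Rightarrow> nat"
  assumes inst: "mp_instance n m p T" and a_mem: "a \<in> p ` {1..n}" and a_pos: "a > 0"
    and feasible: "mod_IP_feasible n m p T a x"
begin

abbreviation "S \<equiv> small_machines n m p T"
abbreviation "B \<equiv> big_machines n m p T"
abbreviation "pm \<equiv> p_max n p"

definition load :: "(nat \<Rightarrow> nat) \<Rightarrow> nat \<Rightarrow> nat" where
  "load f i = (\<Sum>j | j \<in> {1..n} \<and> f j = i. p j)"

text \<open>Assignments map unassigned jobs to \<open>0\<close>, so \<open>load f 0\<close> is the total unassigned time.\<close>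

definition consistent :: "(nat \<Rightarrow> nat) \<Rightarrow> bool" where
  "consistent f \<longleftrightarrow> (\<forall>j\<in>{1..n}. f j \<le> m) \<and> (\<forall>i\<in>S. load f i = T i) \<and>
     (\<forall>i\<in>B. [load f i = T i] (mod a))"

lemma B_iff: "i \<in> B \<longleftrightarrow> 1 \<le> i \<and> i \<le> m \<and> pm ^ 4 \<le> T i"
  by (auto simp: big_machines_def small_machines_def)

lemma S_iff: "i \<in> S \<longleftrightarrow> 1 \<le> i \<and> i \<le> m \<and> \<not> pm ^ 4 \<le> T i"
  by (auto simp: small_machines_def)

lemma finite_B [simp]: "finite B" and finite_S [simp]: "finite S"
  by (auto simp: big_machines_def small_machines_def)

lemma p_le: "j \<in> {1..n} \<Longrightarrow> p j \<le> pm"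
  by (simp add: p_max_def)

lemma a_le: "a \<le> pm"
  using a_mem p_le by auto

section \<open>Moving jobs, total slack and the existence of a receiving machine\<close>

lemma load_assign:
  assumes "X \<subseteq> {1..n}" "\<And>j. j \<in> X \<Longrightarrow> f j \<noteq> i"
  shows "load (\<lambda>j. if j \<in> X then i else f j) i = load f i + sum p X"
proof -
  have "{j. j \<in> {1..n} \<and> (if j \<in> X then i else f j) = i} = {j. j \<in> {1..n} \<and> f j = i} \<union> X"
    using assms(1) by auto
  then show ?thesis
    unfolding load_def using assms
    by (simp only:) (rule sum.union_disjoint; auto intro: finite_subset)
qed

lemma load_assign_other:
  assumes "\<And>j. j \<in> X \<Longrightarrow> f j \<noteq> k" "k \<noteq> i"
  shows "load (\<lambda>j. if j \<in> X then i else f j) k = load f k"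
  unfolding load_def using assms by (intro sum.cong) auto

text \<open>Putting the removed jobs back restores \<open>f\<close>, so this is
  \<open>load_assign\<close> read backwards.\<close>

lemma load_remove:
  assumes "X \<subseteq> {1..n}" "\<And>j. j \<in> X \<Longrightarrow> f j = i" "i \<noteq> 0"
  shows "load f i = load (\<lambda>j. if j \<in> X then 0 else f j) i + sum p X"
proof -
  let ?g = "\<lambda>j. if j \<in> X then 0 else f j"
  have "(\<lambda>j. if j \<in> X then i else ?g j) = f" using assms(2) by auto
  then show ?thesis using load_assign [of X ?g i] assms by simp
qed

lemma consistent_assign:
  assumes f: "consistent f" and X: "X \<subseteq> {1..n}" "\<And>j. j \<in> X \<Longrightarrow> f j = 0"
    and i: "i \<in> B" and dvd: "a dvd sum p X"
  shows "consistent (\<lambda>j. if j \<in> X then i else f j)" (is "consistent ?g")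
proof -
  \<comment> \<open>Index \<open>0\<close> is excluded because the unassigned time does
    shrink.\<close>
  have other: "load ?g k = load f k" if "k \<noteq> i" "k \<noteq> 0" for k
    using that X by (intro load_assign_other) auto
  have same: "load ?g i = load f i + sum p X"
    using X i by (intro load_assign) (auto simp: B_iff)
  have "load ?g k = T k" if "k \<in> S" for k
    using that i f other [of k] by (auto simp: S_iff B_iff consistent_def)
  moreover have "[load ?g k = T k] (mod a)" if "k \<in> B" for k
  proof (cases "k = i")
    case True
    have "[load f i + sum p X = T i + 0] (mod a)"
      using f i dvd by (intro cong_add) (auto simp: consistent_def cong_0_iff)
    then show ?thesis using True same by simp
  next
    case False
    then show ?thesis using that f other [of k] by (auto simp: B_iff consistent_def)
  qed
  ultimately show ?thesis using f i by (auto simp: consistent_def B_iff)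
qed

text \<open>Divisibility is required machine by machine because \<open>X\<close> may be spread over
  several big machines, as when all jobs of time \<open>a\<close> are removed at once.\<close>

lemma consistent_remove:
  assumes f: "consistent f" and X: "\<And>j. j \<in> X \<Longrightarrow> j \<in> {1..n} \<and> f j \<in> B"
    and dvd: "\<And>i. i \<in> B \<Longrightarrow> a dvd (\<Sum>j | j \<in> X \<and> f j = i. p j)"
  shows "consistent (\<lambda>j. if j \<in> X then 0 else f j)" (is "consistent ?g")
proof -
  have "load ?g k = T k" if "k \<in> S" for k
  proof -
    have "load ?g k = load f k"
      unfolding load_def using that X by (intro sum.cong) (auto simp: S_iff B_iff)
    then show ?thesis using that f by (auto simp: consistent_def)
  qed
  moreover have "[load ?g k = T k] (mod a)" if "k \<in> B" for k
  proof -
    let ?Y = "{j. j \<in> X \<and> f j = k}"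
    have "load f k = load (\<lambda>j. if j \<in> ?Y then 0 else f j) k + sum p ?Y"
      using that X by (intro load_remove) (auto simp: B_iff)
    moreover have "load (\<lambda>j. if j \<in> ?Y then 0 else f j) k = load ?g k"
      unfolding load_def using that by (intro sum.cong) (auto simp: B_iff)
    moreover have "[load ?g k + sum p ?Y = load ?g k + 0] (mod a)"
      using dvd [OF that] by (intro cong_add) (auto simp: cong_0_iff)
    ultimately have "[load ?g k = load f k] (mod a)" by (simp add: cong_sym)
    then show ?thesis using that f by (auto simp: consistent_def intro: cong_trans)
  qed
  ultimately show ?thesis using f by (auto simp: consistent_def)
qed

text \<open>Grouping the jobs by machine, with \<open>0\<close> as a dummy machine, and cancelling
  the exactly filled small machines shows that the unassigned time is the total slack of the big
  machines. The additive form is essential over the naturals, since single slacks may be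
  negative.\<close>

lemma total_load:
  assumes "consistent f"
  shows "(\<Sum>i\<in>B. load f i) + load f 0 = (\<Sum>i\<in>B. T i)"
proof -
  have machines: "{0..m} = insert 0 {1..m}" by auto
  have part: "{1..m} = S \<union> B" "S \<inter> B = {}" by (auto simp: S_iff B_iff)
  have "(\<Sum>i\<in>{0..m}. load f i) = (\<Sum>j=1..n. p j)"
    unfolding load_def using assms
    by (subst sum.group [symmetric, of "{1..n}" "{0..m}" f]) (auto simp: consistent_def)
  also have "\<dots> = (\<Sum>i=1..m. T i)" using inst by (simp add: mp_instance_def)
  finally have "load f 0 + (\<Sum>i=1..m. load f i) = (\<Sum>i=1..m. T i)"
    by (simp add: machines)
  moreover have "(\<Sum>i=1..m. g i) = (\<Sum>i\<in>S. g i) + (\<Sum>i\<in>B. g i)" for g :: "nat \<Rightarrow> nat"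
    using part by (metis finite_B finite_S sum.union_disjoint)
  moreover have "(\<Sum>i\<in>S. load f i) = (\<Sum>i\<in>S. T i)"
    using assms by (simp add: consistent_def)
  ultimately show ?thesis by simp
qed

text \<open>If every big machine had slack below \<open>w\<close>, the total slack would be less
  than \<open>card B * w\<close>, whereas \<open>R\<close> alone leaves \<open>card R * a\<close>
  unassigned. Machines above their targets do no harm: a negative slack only lowers the
  total.\<close>

lemma exists_machine_for_bundle:
  assumes f: "consistent f" and R: "\<And>j. j \<in> R \<Longrightarrow> j \<in> {1..n} \<and> f j = 0 \<and> p j = a"
    and many: "pm ^ 2 * card B \<le> card R" and B: "B \<noteq> {}" and w: "w \<le> pm ^ 2"
  shows "\<exists>i\<in>B. load f i + w \<le> T i"
proof (rule ccontr)
  assume "\<not> ?thesis"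
  then have less: "\<And>i. i \<in> B \<Longrightarrow> T i < load f i + w" by force
  have "(\<Sum>i\<in>B. T i) < (\<Sum>i\<in>B. load f i + w)" using B less by (intro sum_strict_mono) auto
  also have "\<dots> = (\<Sum>i\<in>B. load f i) + card B * w" by (simp add: sum.distrib)
  also have "card B * w \<le> card R * a"
  proof -
    have "card B * w \<le> pm ^ 2 * card B" using w by (simp add: mult.commute)
    also have "\<dots> \<le> card R * a" using many a_pos
      by (metis One_nat_def Suc_leI le_trans mult.right_neutral mult_le_mono2)
    finally show ?thesis .
  qed
  also have "card R * a = sum p R" using R by simp
  also have "sum p R \<le> load f 0"
    unfolding load_def using R by (intro sum_mono2) auto
  also have "(\<Sum>i\<in>B. load f i) + load f 0 = (\<Sum>i\<in>B. T i)" by (rule total_load [OF f])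
  finally show False by simp
qed

lemma exists_machine_for_job:
  assumes f: "consistent f" and le: "\<And>i. i \<in> B \<Longrightarrow> load f i \<le> T i"
    and j: "j \<in> {1..n}" "f j = 0" "p j = a"
  shows "\<exists>i\<in>B. load f i + a \<le> T i"
proof -
  have "a = p j" using j by simp
  also have "\<dots> \<le> load f 0" unfolding load_def using j by (intro member_le_sum) auto
  finally have "0 < load f 0" using a_pos by simp
  then have "(\<Sum>i\<in>B. load f i) < (\<Sum>i\<in>B. T i)" using total_load [OF f] by simp
  then obtain i where i: "i \<in> B" "load f i < T i"
    by (meson not_less sum_mono)
  have "[T i = load f i] (mod a)" using f i by (simp add: consistent_def cong_sym)
  then have "a dvd T i - load f i" using i by (simp add: cong_altdef_nat)
  then have "a \<le> T i - load f i" using i by (intro dvd_imp_le) auto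
  then show ?thesis using i by (intro bexI [of _ i]) auto
qed

lemma all_targets_met:
  assumes f: "consistent f" and le: "\<And>i. i \<in> B \<Longrightarrow> load f i \<le> T i"
    and all: "\<And>j. j \<in> {1..n} \<Longrightarrow> f j \<noteq> 0" and i: "i \<in> {1..m}"
  shows "load f i = T i"
proof (cases "i \<in> S")
  case True
  then show ?thesis using f by (simp add: consistent_def)
next
  case False
  then have "i \<in> B" using i by (auto simp: S_iff B_iff)
  have "{j. j \<in> {1..n} \<and> f j = 0} = {}" using all by auto
  then have "load f 0 = 0" unfolding load_def by (simp only: sum.empty)
  then have "(\<Sum>i\<in>B. load f i) = (\<Sum>i\<in>B. T i)" using total_load [OF f] by simp
  then show ?thesis using le \<open>i \<in> B\<close> by (metis finite_B sum_mono_inv)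
qed

lemma load_le_target:
  assumes i: "i \<in> B" and no_a: "\<And>j. j \<in> {1..n} \<Longrightarrow> f j = i \<Longrightarrow> p j \<noteq> a"
    and few: "\<And>b. b \<noteq> a \<Longrightarrow> card {j \<in> {1..n}. f j = i \<and> p j = b} < a"
  shows "load f i \<le> T i"
proof -
  let ?J = "{j \<in> {1..n}. f j = i}"
  have "load f i = (\<Sum>j\<in>?J. p j)" by (simp add: load_def)
  also have "\<dots> = (\<Sum>b=0..pm. \<Sum>j | j \<in> ?J \<and> p j = b. p j)"
    by (rule sum.group [symmetric]) (use p_le in auto)
  \<comment> \<open>Jobs of time \<open>0\<close> contribute nothing. Dropping their class leaves
    \<open>pm\<close> classes instead of \<open>pm + 1\<close>, which gives exactly the
    cube.\<close>
  also have "\<dots> = (\<Sum>b=1..pm. \<Sum>j | j \<in> ?J \<and> p j = b. p j)"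
    by (simp add: sum.atLeast_Suc_atMost [of 0])
  also have "\<dots> \<le> (\<Sum>b=1..pm. pm * pm)"
  proof (rule sum_mono)
    fix b assume b: "b \<in> {1..pm}"
    have "card {j. j \<in> ?J \<and> p j = b} \<le> a"
    proof (cases "b = a")
      case True
      then have "{j. j \<in> ?J \<and> p j = b} = {}" using no_a by auto
      then show ?thesis by (simp only: card.empty)
    next
      case False
      have "{j. j \<in> ?J \<and> p j = b} = {j \<in> {1..n}. f j = i \<and> p j = b}" by auto
      then show ?thesis using few [OF False] by simp
    qed
    then have "card {j. j \<in> ?J \<and> p j = b} * b \<le> pm * pm"
      using a_le b by (intro mult_mono) auto
    then show "(\<Sum>j | j \<in> ?J \<and> p j = b. p j) \<le> pm * pm" by simp
  qed
  also have "\<dots> = pm ^ 3" by (simp add: power3_eq_cube)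
  \<comment> \<open>Raising the exponent needs \<open>pm\<close> \<ge> 1, which follows from
    \<open>0 < a\<close> \<le> \<open>pm\<close>.\<close>
  also have "\<dots> \<le> pm ^ 4" using a_pos a_le by (intro power_increasing) auto
  also have "\<dots> \<le> T i" using i by (simp add: B_iff)
  finally show ?thesis .
qed

section \<open>The assignment encoded by a feasible solution\<close>

lemma x_unique:
  assumes "j \<in> {1..n}"
  obtains i where "i \<in> {1..m}" "\<And>k. k \<in> {1..m} \<Longrightarrow> x k j = (if k = i then 1 else 0)"
proof -
  have s: "(\<Sum>k=1..m. x k j) = 1" using feasible assms by (auto simp: mod_IP_feasible_def)
  then obtain i where i: "i \<in> {1..m}" "x i j \<noteq> 0"
    by (metis One_nat_def sum.neutral zero_neq_one)
  have "x i j + (\<Sum>k\<in>{1..m} - {i}. x k j) = 1" using s i by (simp add: sum.remove)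
  then have "x i j = 1" and "(\<Sum>k\<in>{1..m} - {i}. x k j) = 0" using i(2) by linarith+
  then have "x i j = 1" and "\<forall>k\<in>{1..m} - {i}. x k j = 0" by (simp_all only: sum_eq_0_iff finite_Diff finite_atLeastAtMost)
  then show ?thesis using that [of i] i by auto
qed

text \<open>The hypothesis on \<open>f\<close> is what the initial double loop leaves behind. As
  each job has exactly one machine with entry \<open>1\<close>, it already determines
  \<open>f\<close> on all jobs.\<close>

lemma start_consistent:
  assumes f: "\<And>i j. i \<in> {1..m} \<Longrightarrow> j \<in> {1..n} \<Longrightarrow> x i j = 1 \<Longrightarrow> f j = i"
  shows "consistent f" and "\<And>j. j \<in> {1..n} \<Longrightarrow> f j \<in> {1..m}"
    and "pm ^ 2 * card B \<le> card {j \<in> {1..n}. p j = a \<and> f j \<in> B}"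
proof -
  have xf: "x i j = (if f j = i then 1 else 0)" if "i \<in> {1..m}" "j \<in> {1..n}" for i j
    using x_unique [OF that(2)] f that by metis
  show fm: "f j \<in> {1..m}" if j: "j \<in> {1..n}" for j
    using x_unique [OF j] f [OF _ j] by metis
  have load: "(\<Sum>j=1..n. p j * x i j) = load f i" if "i \<in> {1..m}" for i
  proof -
    have "(\<Sum>j=1..n. p j * x i j) = (\<Sum>j=1..n. if f j = i then p j else 0)"
      using that by (intro sum.cong) (auto simp: xf)
    also have "\<dots> = load f i"
      unfolding load_def by (simp only: sum.inter_filter [symmetric] finite_atLeastAtMost)
    finally show ?thesis .
  qed
  show "consistent f"
    unfolding consistent_def using feasible load fm
    by (auto simp: mod_IP_feasible_def S_iff B_iff)
  \<comment> \<open>For a fixed job the sum over the big machines is the indicator of its machine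
    being big, so the covering constraint counts the jobs that Phase I will remove first.\<close>
  have "(\<Sum>j\<in>{j\<in>{1..n}. p j = a}. \<Sum>i\<in>B. x i j) =
      (\<Sum>j\<in>{j\<in>{1..n}. p j = a}. if f j \<in> B then 1 else 0)"
  proof (intro sum.cong refl)
    fix j assume "j \<in> {j\<in>{1..n}. p j = a}"
    then have "(\<Sum>i\<in>B. x i j) = (\<Sum>i\<in>B. if f j = i then 1 else 0)"
      by (intro sum.cong) (auto simp: xf B_iff)
    then show "(\<Sum>i\<in>B. x i j) = (if f j \<in> B then 1 else 0)" by simp
  qed
  also have "\<dots> = card {j \<in> {1..n}. p j = a \<and> f j \<in> B}"
    by (simp add: sum.If_cases Int_def conj_assoc)
  finally show "pm ^ 2 * card B \<le> card {j \<in> {1..n}. p j = a \<and> f j \<in> B}"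
    using feasible by (simp add: mod_IP_feasible_def)
qed

subsection \<open>The building blocks of the procedure\<close>

definition has_input :: "state \<Rightarrow> bool" where
  "has_input s \<longleftrightarrow> s NJobs [] = n \<and> s NMachines [] = m \<and> (\<forall>j. s PTime [j] = p j) \<and>
     (\<forall>i. s Target [i] = T i) \<and> s AVal [] = a"

definition ready :: "state \<Rightarrow> bool" where
  "ready s \<longleftrightarrow> has_input s \<and> s Thresh [] = pm ^ 4"

lemma ready_agree:
  assumes "ready t" "agree X s t" "X \<inter> {NJobs, NMachines, PTime, Target, AVal, Thresh} = {}"
  shows "ready s"
  using assms by (auto simp: ready_def has_input_def agree_def)

lemma m_le_n: "m \<le> n"
  using inst by (simp add: mp_instance_def)

lemma x_inj:
  assumes "i \<in> {1..m}" "i' \<in> {1..m}" "j \<in> {1..n}" "x i j = 1" "x i' j = 1"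
  shows "i = i'"
  using x_unique [OF assms(3)] assms by (metis zero_neq_one)

lemma wp_start_assignment:
  assumes s: "has_input s" "\<And>i j. s XSol [i, j] = x i j"
  shows "wp n start_assignment
    (\<lambda>t. ready t \<and> (\<forall>i\<in>{1..m}. \<forall>j\<in>{1..n}. x i j = 1 \<longrightarrow> t Asg [j] = i)) s"
proof -
  \<comment> \<open>The inserted \<open>0\<close> is the initial value of \<open>PMax\<close>; it
    also keeps \<open>Max\<close> meaningful before the first round.\<close>
  let ?J1 = "\<lambda>k t. t PMax [] = Max (insert 0 (p ` {1..k}))"
  let ?J2 = "\<lambda>k t. \<forall>i\<in>{1..k}. \<forall>j\<in>{1..n}. x i j = 1 \<longrightarrow> t Asg [j] = i"
  let ?J3 = "\<lambda>i k t. ?J2 i t \<and> (\<forall>j\<in>{1..k}. x (Suc i) j = 1 \<longrightarrow> t Asg [j] = Suc i)"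
  have pmax: "Max (insert 0 (p ` {1..n})) = pm"
    using a_mem by (auto simp: p_max_def)
  show ?thesis
    unfolding start_assignment_def wp_simps
  proof (rule wp_for [where K = n and J = ?J1], goal_cases)
    case (7 k t)
    have "insert 0 (p ` {1..Suc k}) = insert (p (Suc k)) (insert 0 (p ` {1..k}))"
      using atLeastAtMostSuc_conv [of 1 k] by (simp only: image_insert insert_commute)
    then have "Max (insert 0 (p ` {1..Suc k})) = max (p (Suc k)) (t PMax [])"
      using 7 by (simp only:) (subst Max_insert; simp)
    moreover have "t PTime [Suc k] = p (Suc k)"
      using 7 s by (simp add: agree_def upd_simps has_input_def)
    ultimately show ?case using 7(3) by (simp add: upd_simps max_def)
  next
    case (8 t)
    then have t: "has_input t" "\<And>i j. t XSol [i, j] = x i j" "t PMax [] = pm"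
      using s by (simp_all add: agree_def upd_simps has_input_def pmax del: One_nat_def)
    show ?case
    proof (rule wp_for [where K = m and J = ?J2], goal_cases)
      case (7 k u)
      have u: "u XSol [i, j] = x i j" "u NJobs [] = n" for i j
        using 7 t by (simp_all add: agree_def upd_simps has_input_def)
      show ?case unfolding wp_simps
      proof (rule wp_for [where K = n and J = "?J3 k"], goal_cases)
        case (7 l v)
        \<comment> \<open>The current machine must not overwrite an entry made for an earlier one; a
          job selected by \<open>x\<close> for both would contradict uniqueness.\<close>
        have "x i (Suc l) \<noteq> 1" if "x (Suc k) (Suc l) = 1" "i \<in> {1..k}" for i
          using x_inj [of i "Suc k" "Suc l"] that \<open>k < m\<close> \<open>l < n\<close> by auto
        moreover have "v XSol [Suc k, Suc l] = x (Suc k) (Suc l)" "v Ix [] = Suc k"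
          using 7 \<open>u Ix [] = Suc k\<close> u by (simp_all add: agree_def upd_simps)
        ultimately show ?case using 7(1-3) by (auto simp: upd_simps le_Suc_eq)
      next
        case (8 v)
        then show ?case by (auto simp: le_Suc_eq)
      qed (use 7 u in \<open>simp_all add: agree_def upd_simps\<close>)
    next
      case (8 u)
      then show ?case using t
        by (simp add: agree_def upd_simps has_input_def ready_def power4_eq_xxxx mult.assoc)
    qed (use m_le_n t in \<open>simp_all add: agree_def upd_simps has_input_def\<close>)
  qed (use s in \<open>simp_all add: agree_def upd_simps has_input_def\<close>)
qed

lemma wp_remove_a_jobs:
  assumes s: "ready s" "\<And>j. j \<in> {1..n} \<Longrightarrow> s Asg [j] \<in> {1..m}"
    and X: "X = {j \<in> {1..n}. p j = a \<and> s Asg [j] \<in> B}"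
  shows "wp n remove_a_jobs
    (\<lambda>t. (\<forall>j. t Asg [j] = (if j \<in> X then 0 else s Asg [j])) \<and>
         stack (\<lambda>r. t RemA [r]) (t NumA []) X) s"
proof -
  let ?X = "\<lambda>k. {j \<in> {1..k}. p j = a \<and> s Asg [j] \<in> B}"
  let ?J = "\<lambda>k t. (\<forall>j. t Asg [j] = (if j \<in> ?X k then 0 else s Asg [j])) \<and>
         stack (\<lambda>r. t RemA [r]) (t NumA []) (?X k)"
  show ?thesis
    unfolding remove_a_jobs_def wp_simps
  proof (rule wp_for [where K = n and J = ?J], goal_cases)
    case (7 k t)
    have t: "t AVal [] = a" "t Thresh [] = pm ^ 4" "t PTime [Suc k] = p (Suc k)"
      "\<And>i. t Target [i] = T i"
      using 7 s by (simp_all add: agree_def upd_simps ready_def has_input_def)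
    have J: "\<And>j. t Asg [j] = (if j \<in> ?X k then 0 else s Asg [j])"
      "stack (\<lambda>r. t RemA [r]) (t NumA []) (?X k)" using 7(2) by blast+
    have new: "t Asg [Suc k] = s Asg [Suc k]" "Suc k \<notin> ?X k" using J by auto
    let ?b = "p (Suc k) = a \<and> pm ^ 4 \<le> T (s Asg [Suc k])"
    \<comment> \<open>The program compares only the target with the threshold; that the index
      denotes a machine at all comes from the initial assignment being total.\<close>
    have b: "?b \<longleftrightarrow> p (Suc k) = a \<and> s Asg [Suc k] \<in> B"
      using s(2) [of "Suc k"] 7(1) by (auto simp: B_iff)
    show ?case
    proof (cases ?b)
      case True
      then have "?X (Suc k) = insert (Suc k) (?X k)" using b by (auto simp: le_Suc_eq)
      then show ?thesis
        using True 7(3) t new(1) J(1) stack_push [OF J(2) new(2)]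
        by (simp add: upd_simps cong: if_cong)
    next
      case False
      then have "?X (Suc k) = ?X k" using b by (auto simp: le_Suc_eq)
      then show ?thesis using False 7(3) t new J by (auto simp: upd_simps)
    qed
  next
    case (8 t)
    then show ?case using X by simp
  qed (use s in \<open>simp_all add: agree_def upd_simps ready_def has_input_def stack_empty\<close>)
qed

definition crowded :: "(nat \<Rightarrow> nat) \<Rightarrow> nat \<Rightarrow> nat \<Rightarrow> bool" where
  "crowded f i b \<longleftrightarrow> i \<in> B \<and> b \<noteq> a \<and> a \<le> card {j \<in> {1..n}. f j = i \<and> p j = b}"

text \<open>Tailored to the loop of Phase I: whichever listed pair is picked may be removed, and an
  empty list certifies that no crowded pair is left.\<close>

lemma wp_find_groups:
  assumes s: "ready s" and f: "\<And>j. s Asg [j] = f j"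
  shows "wp n find_groups
    (\<lambda>t. (\<forall>r<t NumC []. crowded f (t CandM [r]) (t CandB [r])) \<and>
         ((\<exists>i b. crowded f i b) \<longrightarrow> 0 < t NumC [])) s"
proof -
  let ?J1 = "\<lambda>k t. (\<forall>r<t NumC []. crowded f (t CandM [r]) (t CandB [r])) \<and>
         ((\<exists>i b. crowded f i b \<and> i \<le> k) \<longrightarrow> 0 < t NumC [])"
  \<comment> \<open>The machines before \<open>i\<close> have been treated, hence
    \<open>i - 1\<close>; for \<open>i\<close> itself a value is covered as soon as one job carrying
    it has been scanned.\<close>
  let ?J2 = "\<lambda>i l t. ?J1 (i - 1) t \<and>
         ((\<exists>j\<in>{1..l}. crowded f i (p j) \<and> f j = i) \<longrightarrow> 0 < t NumC [])"
  let ?J3 = "\<lambda>i b q t. t Cnt [] = card {j \<in> {1..q}. f j = i \<and> p j = b}"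
  have nonempty: "\<exists>j\<in>{1..n}. crowded f i (p j) \<and> f j = i" if "crowded f i b" for i b
  proof -
    have "{j \<in> {1..n}. f j = i \<and> p j = b} \<noteq> {}"
      using that a_pos unfolding crowded_def by (metis card.empty le_zero_eq not_gr_zero)
    then show ?thesis using that by blast
  qed
  show ?thesis
    unfolding find_groups_def wp_simps
  proof (rule wp_for [where K = m and J = ?J1], goal_cases)
    case (7 k t)
    have t: "t AVal [] = a" "t Thresh [] = pm ^ 4" "t NJobs [] = n" "\<And>j. t PTime [j] = p j"
      "\<And>j. t Asg [j] = f j" "\<And>i. t Target [i] = T i"
      using 7(4) s f by (simp_all add: agree_def upd_simps ready_def has_input_def)
    show ?case
    proof (cases "Suc k \<in> B")
      case False
      then have "\<not> pm ^ 4 \<le> T (Suc k)" using 7(1) by (auto simp: B_iff)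
      moreover have "\<not> crowded f (Suc k) b" for b using False by (simp add: crowded_def)
      ultimately show ?thesis using 7(2,3) t by (simp add: le_Suc_eq) metis
    next
      case True
      then have big: "bval t (is_big (Var Ix))" using 7(3) t by (simp add: B_iff)
      show ?thesis unfolding wp_simps if_P [OF big]
      proof (rule wp_for [where K = n and J = "?J2 (Suc k)"], goal_cases)
        case (7 l u)
        have u: "u AVal [] = a" "u NJobs [] = n" "\<And>j. u PTime [j] = p j"
          "\<And>j. u Asg [j] = f j" "u Ix [] = Suc k"
          using 7(4) t \<open>t Ix [] = Suc k\<close> by (simp_all add: agree_def upd_simps)
        show ?case
        proof (cases "f (Suc l) = Suc k \<and> p (Suc l) \<noteq> a")
          case False
          then have "\<not> (crowded f (Suc k) (p (Suc l)) \<and> f (Suc l) = Suc k)"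
            by (auto simp: crowded_def)
          then have "?J2 (Suc k) (Suc l) u"
            using 7(2) by (auto simp: le_Suc_eq)
          then show ?thesis using False 7(3) u by auto
        next
          case job: True
          then have cond: "bval u (Get Asg [Var Jx] [=] Var Ix [&] Neg (Get PTime [Var Jx] [=] Var AVal))"
            using u 7(3) by simp
          show ?thesis unfolding wp_simps if_P [OF cond]
          proof (rule wp_for [where K = n and J = "?J3 (Suc k) (p (Suc l))"], goal_cases)
            case (7 q v)
            have v: "\<And>j. v PTime [j] = p j" "\<And>j. v Asg [j] = f j" "v Ix [] = Suc k" "v Jx [] = Suc l"
              using 7(4) u \<open>u Jx [] = Suc l\<close> by (simp_all add: agree_def upd_simps)
            show ?case
              using 7(2,3) v card_filter_Suc [where k = q and P = "\<lambda>j. f j = Suc k \<and> p j = p (Suc l)"]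
              by (simp add: upd_simps)
          next
            case (8 v)
            have v: "\<And>j. v PTime [j] = p j" "v AVal [] = a" "v Ix [] = Suc k" "v Jx [] = Suc l"
              "v NumC = u NumC" "v CandM = u CandM" "v CandB = u CandB"
              using 8(2) u \<open>u Jx [] = Suc l\<close> by (simp_all add: agree_def upd_simps)
            have cr: "a \<le> v Cnt [] \<longleftrightarrow> crowded f (Suc k) (p (Suc l))"
              using 8(1) True job by (auto simp: crowded_def)
            show ?case
            proof (cases "a \<le> v Cnt []")
              case True
              then show ?thesis using cr v \<open>?J2 (Suc k) l u\<close> by (auto simp: upd_simps)
            next
              case False
              then show ?thesis using cr v \<open>?J2 (Suc k) l u\<close> by (auto simp: upd_simps le_Suc_eq)
            qed
          qed (use u in \<open>simp_all add: agree_def upd_simps\<close>)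
        qed
      next
        case (8 u)
        then show ?case using nonempty by (auto simp: le_Suc_eq)
      next
        case 5
        then show ?case by (simp add: upd_simps)
      next
        case 6
        then show ?case using \<open>?J1 k t\<close> by (simp add: upd_simps)
      qed (use t in \<open>simp_all add: agree_def upd_simps\<close>)
    qed
  next
    case (8 t)
    have "i \<le> m" if "crowded f i b" for i b using that by (simp add: crowded_def B_iff)
    then show ?case using 8 by blast
  next
    case 6
    show ?case by (auto simp: upd_simps crowded_def B_iff)
  qed (use s m_le_n in \<open>simp_all add: agree_def upd_simps ready_def has_input_def\<close>)
qed

lemma wp_choose_machine:
  assumes s: "ready s" and f: "\<And>j. s Asg [j] = f j"
    and ex: "\<exists>i\<in>B. load f i + s Wt [] \<le> T i"
  shows "wp n choose_machine
    (\<lambda>t. t Mach [] \<in> B \<and> load f (t Mach []) + s Wt [] \<le> T (t Mach [])) s"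
proof -
  let ?fits = "\<lambda>i. i \<in> B \<and> load f i + s Wt [] \<le> T i"
  let ?J1 = "\<lambda>k t. (\<forall>r<t NumC []. ?fits (t CandM [r])) \<and>
         ((\<exists>i\<le>k. ?fits i) \<longrightarrow> 0 < t NumC [])"
  let ?J2 = "\<lambda>i q t. t Load [] = (\<Sum>j\<in>{j \<in> {1..q}. f j = i}. p j)"
  show ?thesis
    unfolding choose_machine_def wp_simps
  proof (rule wp_for [where K = m and J = ?J1], goal_cases)
    case (7 k t)
    have t: "t Wt = s Wt" "t Thresh [] = pm ^ 4" "t NJobs [] = n" "\<And>j. t PTime [j] = p j"
      "\<And>j. t Asg [j] = f j" "\<And>i. t Target [i] = T i"
      using 7(4) s f by (simp_all add: agree_def upd_simps ready_def has_input_def)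
    show ?case
    proof (cases "Suc k \<in> B")
      case False
      then have "\<not> pm ^ 4 \<le> T (Suc k)" using 7(1) by (auto simp: B_iff)
      then show ?thesis using False 7(2,3) t by (auto simp: le_Suc_eq)
    next
      case True
      then have big: "bval t (is_big (Var Ix))" using 7(3) t by (simp add: B_iff)
      show ?thesis unfolding wp_simps if_P [OF big]
      proof (rule wp_for [where K = n and J = "?J2 (Suc k)"], goal_cases)
        case (7 q v)
        have v: "\<And>j. v PTime [j] = p j" "\<And>j. v Asg [j] = f j" "v Ix [] = Suc k"
          using 7(4) t \<open>t Ix [] = Suc k\<close> by (simp_all add: agree_def upd_simps)
        show ?case
          using 7(2,3) v sum_filter_Suc [where k = q and P = "\<lambda>j. f j = Suc k" and g = p] by (simp add: upd_simps)
      next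
        case (8 v)
        have v: "\<And>i. v Target [i] = T i" "v Wt = s Wt" "v Ix [] = Suc k"
          "v NumC = t NumC" "v CandM = t CandM"
          using 8(2) t \<open>t Ix [] = Suc k\<close> by (simp_all add: agree_def upd_simps)
        have "v Load [] = load f (Suc k)" using 8(1) by (simp add: load_def)
        then show ?case using \<open>?J1 k t\<close> True v
          by (cases "load f (Suc k) + s Wt [] \<le> T (Suc k)") (auto simp: upd_simps le_Suc_eq)
      qed (use t in \<open>simp_all add: agree_def upd_simps\<close>)
    qed
  next
    case (8 t)
    \<comment> \<open>The fitting machine supplied by \<open>ex\<close> is what keeps the concluding
      \<open>Pick\<close> from being stuck.\<close>
    have "0 < t NumC []" using 8(1) ex by (auto simp: B_iff)
    then show ?case using 8(1) by (simp add: upd_simps)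
  next
    case 6
    show ?case by (auto simp: upd_simps B_iff)
  qed (use s m_le_n in \<open>simp_all add: agree_def upd_simps ready_def has_input_def\<close>)
qed

abbreviation asg :: "state \<Rightarrow> nat \<Rightarrow> nat" where
  "asg s \<equiv> \<lambda>j. s Asg [j]"

text \<open>The set \<open>X\<close> depends on the picks and is therefore existential. The
  bijection records that the row of \<open>Bundle\<close> lists it without repetition, so that
  summing over positions later gives the weight of the bundle.\<close>

lemma wp_remove_bundle:
  assumes s: "ready s" and C: "C = {j \<in> {1..n}. s Asg [j] = s Mach [] \<and> p j = s Val []}"
    and many: "a \<le> card C" and q: "q = s NumB []"
  shows "wp n remove_bundle
    (\<lambda>t. \<exists>X. X \<subseteq> C \<and> card X = a \<and> (\<forall>j. t Asg [j] = (if j \<in> X then 0 else s Asg [j])) \<and>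
         bij_betw (\<lambda>k. t Bundle [q, k]) {1..a} X \<and>
         (\<forall>q' k. q' \<noteq> q \<longrightarrow> t Bundle [q', k] = s Bundle [q', k]) \<and>
         t Pend = (s Pend)([q] := q) \<and> t NumB [] = Suc q) s"
proof -
  let ?C = "\<lambda>k. {j \<in> {1..k}. s Asg [j] = s Mach [] \<and> p j = s Val []}"
  let ?J1 = "\<lambda>k t. stack (\<lambda>r. t Items [r]) (t NumL []) (?C k)"
  let ?J2 = "\<lambda>k t. \<exists>X. X \<subseteq> C \<and> card X = k \<and> stack (\<lambda>r. t Items [r]) (t NumL []) (C - X) \<and>
         (\<forall>j. t Asg [j] = (if j \<in> X then 0 else s Asg [j])) \<and>
         bij_betw (\<lambda>k. t Bundle [q, k]) {1..k} X \<and>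
         (\<forall>q' k. q' \<noteq> q \<longrightarrow> t Bundle [q', k] = s Bundle [q', k])"
  have "C \<subseteq> {1..n}" using C by blast
  then have finC: "finite C" and "card C \<le> n"
    using card_mono [of "{1..n}" C] by (simp_all add: finite_subset del: One_nat_def)
  \<comment> \<open>This bounds the drawing loop, whose length is \<open>a\<close>, by
    \<open>n\<close> iterations.\<close>
  then have an: "a \<le> n" using many by simp
  show ?thesis
    unfolding remove_bundle_def wp_simps
  proof (rule wp_for [where K = n and J = ?J1], goal_cases)
    case (7 k t)
    have t: "\<And>j. t PTime [j] = p j" "t Asg = s Asg" "t Mach = s Mach" "t Val = s Val"
      using 7(4) s by (simp_all add: agree_def upd_simps ready_def has_input_def)
    show ?case
    proof (cases "Suc k \<in> ?C (Suc k)")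
      case True
      then have "?C (Suc k) = insert (Suc k) (?C k)" "Suc k \<notin> ?C k"
        "s Asg [Suc k] = s Mach []" "p (Suc k) = s Val []" by (auto simp: le_Suc_eq)
      then show ?thesis using 7(3) t stack_push [OF 7(2), of "Suc k"]
        by (simp add: upd_simps cong: if_cong)
    next
      case False
      then have "?C (Suc k) = ?C k" "\<not> (s Asg [Suc k] = s Mach [] \<and> p (Suc k) = s Val [])"
        by (auto simp: le_Suc_eq)
      then show ?thesis using 7(2,3) t by (auto simp: upd_simps)
    qed
  next
    case (8 t)
    have t: "t AVal [] = a" "t Asg = s Asg" "t Bundle = s Bundle" "t NumB [] = q" "t Pend = s Pend"
      using 8(2) s q by (simp_all add: agree_def upd_simps ready_def has_input_def)
    have stack: "stack (\<lambda>r. t Items [r]) (t NumL []) C" using 8(1) C by simp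
    show ?case
    proof (rule wp_for [where K = a and J = ?J2], goal_cases)
      case (7 k u)
      have u: "u NumB [] = q" using 7(4) t by (simp add: agree_def upd_simps)
      from 7(2) obtain X where X: "X \<subseteq> C" "card X = k"
        "stack (\<lambda>r. u Items [r]) (u NumL []) (C - X)"
        "\<And>j. u Asg [j] = (if j \<in> X then 0 else s Asg [j])"
        "bij_betw (\<lambda>k. u Bundle [q, k]) {1..k} X"
        "\<And>q' k. q' \<noteq> q \<Longrightarrow> u Bundle [q', k] = s Bundle [q', k]"
        by blast
      \<comment> \<open>After \<open>k < a\<close> draws from at least \<open>a\<close> jobs
        something is left, so the \<open>Pick\<close> cannot be stuck.\<close>
      have "u NumL [] = card C - k"
        using stack_card [OF X(3)] X(1,2) finC by (simp add: card_Diff_subset finite_subset)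
      then have pos: "0 < u NumL []" using many 7(1) by simp
      show ?case unfolding wp_simps
      proof (intro conjI allI impI, goal_cases)
        case 1
        show ?case using pos by simp
      next
        case (2 r)
        then have r: "r < u NumL []" by simp
        let ?y = "u Items [r]"
        have y: "?y \<in> C" "?y \<notin> X"
          and st: "stack (\<lambda>r'. if r' = r then u Items [u NumL [] - Suc 0] else u Items [r'])
            (u NumL [] - Suc 0) (C - X - {?y})"
          using stack_take [OF X(3) r] by auto
        have "C - X - {?y} = C - insert ?y X" by auto
        note st = st [unfolded this]
        have "card (insert ?y X) = Suc k"
          using X(1,2) y finC by (simp add: card_insert_if finite_subset)
        moreover have "bij_betw (\<lambda>l. if l = Suc k then ?y else u Bundle [q, l]) {1..Suc k} (insert ?y X)"
          by (rule bij_betw_extend [OF X(5) y(2)])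
        ultimately show ?case
          using X y st 7(3) u by (intro exI [of _ "insert ?y X"]) (simp add: upd_simps cong: if_cong)
      qed
    next
      case (8 u)
      then have "u NumB [] = q" "u Pend = s Pend" using t by (simp_all add: agree_def upd_simps)
      moreover obtain X where "X \<subseteq> C" "card X = a"
        "\<And>j. u Asg [j] = (if j \<in> X then 0 else s Asg [j])"
        "bij_betw (\<lambda>k. u Bundle [q, k]) {1..a} X"
        "\<And>q' k. q' \<noteq> q \<Longrightarrow> u Bundle [q', k] = s Bundle [q', k]"
        using 8(1) by blast
      ultimately show ?case by (intro exI [of _ X]) (simp add: upd_simps fun_upd_def)
    next
      case 5
      then show ?case by (simp add: upd_simps)
    next
      case 6
      then show ?case using t stack by (intro exI [of _ "{}"]) (simp add: upd_simps bij_betw_def)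
    qed (use t an in \<open>simp_all add: agree_def upd_simps\<close>)
  qed (use s in \<open>simp_all add: agree_def upd_simps ready_def has_input_def stack_empty\<close>)
qed

section \<open>Bookkeeping of removed jobs and pending bundles\<close>

abbreviation bundle_jobs :: "state \<Rightarrow> nat \<Rightarrow> nat set" where
  "bundle_jobs s q \<equiv> (\<lambda>k. s Bundle [q, k]) ` {1..a}"

text \<open>\<open>P\<close> is the set of numbers of the bundles still to be reassigned, \<open>R\<close> the set of removed jobs of
  processing time \<open>a\<close>.\<close>

definition pending :: "state \<Rightarrow> nat set \<Rightarrow> nat set \<Rightarrow> bool" where
  "pending s P R \<longleftrightarrow> stack (\<lambda>r. s RemA [r]) (s NumA []) R \<and> stack (\<lambda>r. s Pend [r]) (s NumB []) P \<and>
     R \<union> (\<Union>q\<in>P. bundle_jobs s q) = {j \<in> {1..n}. s Asg [j] = 0} \<and> (\<forall>j\<in>R. p j = a) \<and>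
     (\<forall>q\<in>P. inj_on (\<lambda>k. s Bundle [q, k]) {1..a}) \<and> disjoint_family_on (bundle_jobs s) P \<and>
     (\<forall>q\<in>P. \<exists>b. b \<noteq> a \<and> (\<forall>j\<in>bundle_jobs s q. p j = b))"

lemma pending_agree:
  assumes "pending s P R" "agree X t s" "X \<inter> {Asg, RemA, NumA, Pend, NumB, Bundle} = {}"
  shows "pending t P R"
proof -
  have "t Asg = s Asg" "t RemA = s RemA" "t NumA = s NumA" "t Pend = s Pend" "t NumB = s NumB"
    "t Bundle = s Bundle"
    using assms(2,3) by (simp_all add: agree_def)
  then show ?thesis using assms(1) by (simp add: pending_def)
qed

text \<open>Disjoint bundles have distinct first jobs, and a first job exists because
  \<open>a\<close> is positive. These bounds limit the loops of Phases II and III.\<close>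

lemma pending_card:
  assumes "pending s P R"
  shows "s NumB [] \<le> n" "s NumA [] \<le> n"
proof -
  have 1: "1 \<in> {1..a}" using a_pos by simp
  have sub: "R \<union> (\<Union>q\<in>P. bundle_jobs s q) \<subseteq> {1..n}" using assms by (auto simp: pending_def)
  have "disjoint_family_on (bundle_jobs s) P" using assms by (simp add: pending_def)
  then have "inj_on (\<lambda>q. s Bundle [q, 1]) P"
    using 1 unfolding disjoint_family_on_def inj_on_def by blast
  moreover have "(\<lambda>q. s Bundle [q, 1]) ` P \<subseteq> {1..n}" using sub 1 by blast
  ultimately have "card P \<le> card {1..n}" by (intro card_inj_on_le) auto
  moreover have "card P = s NumB []" using assms by (auto simp: pending_def intro: stack_card)
  ultimately show "s NumB [] \<le> n" by simp
  have "card R \<le> card {1..n}" using sub by (intro card_mono) auto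
  moreover have "card R = s NumA []" using assms by (auto simp: pending_def intro: stack_card)
  ultimately show "s NumA [] \<le> n" by simp
qed

lemma pending_push:
  assumes pend: "pending s P R" and q: "q \<notin> P" "q = s NumB []" and X: "X \<subseteq> {1..n}"
    "\<And>j. j \<in> X \<Longrightarrow> s Asg [j] \<noteq> 0" "\<And>j. j \<in> X \<Longrightarrow> p j = b" "b \<noteq> a"
    and asg: "\<And>j. t Asg [j] = (if j \<in> X then 0 else s Asg [j])"
    and bij: "bij_betw (\<lambda>k. t Bundle [q, k]) {1..a} X"
    and same: "\<And>q' k. q' \<noteq> q \<Longrightarrow> t Bundle [q', k] = s Bundle [q', k]"
      "t RemA = s RemA" "t NumA = s NumA"
    and new: "t Pend = (s Pend)([q] := q)" "t NumB [] = Suc q"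
  shows "pending t (insert q P) R"
proof -
  have bq: "bundle_jobs t q = X" using bij by (simp add: bij_betw_def)
  have bP: "bundle_jobs t q' = bundle_jobs s q'" if "q' \<in> P" for q'
    using same(1) [of q'] q(1) that by (intro image_cong) auto
  have un: "R \<union> (\<Union>q\<in>P. bundle_jobs s q) = {j \<in> {1..n}. s Asg [j] = 0}"
    using pend by (simp add: pending_def)
  have "R \<union> (\<Union>q'\<in>insert q P. bundle_jobs t q') = X \<union> (R \<union> (\<Union>q\<in>P. bundle_jobs s q))"
    using bq bP by auto
  also have "\<dots> = {j \<in> {1..n}. t Asg [j] = 0}"
    unfolding un asg using X(1) by auto
  finally have 1: "R \<union> (\<Union>q'\<in>insert q P. bundle_jobs t q') = {j \<in> {1..n}. t Asg [j] = 0}" .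
  \<comment> \<open>The new bundle was assigned up to now, the pending ones were not.\<close>
  have "X \<inter> bundle_jobs s q' = {}" if "q' \<in> P" for q'
    using un X(2) that by blast
  moreover have "disjoint_family_on (bundle_jobs s) P" using pend by (simp add: pending_def)
  ultimately have 2: "disjoint_family_on (bundle_jobs t) (insert q P)"
    using disjoint_family_on_extend [of "bundle_jobs s" P "bundle_jobs t" q] by (simp only: bq bP)
  have 3: "stack (\<lambda>r. t Pend [r]) (t NumB []) (insert q P)"
    using pend q new stack_push [of "\<lambda>r. s Pend [r]" "s NumB []" P q]
    by (simp add: pending_def cong: if_cong)
  have 4: "\<forall>q'\<in>insert q P. inj_on (\<lambda>k. t Bundle [q', k]) {1..a}"
  proof
    fix q' assume "q' \<in> insert q P"
    then show "inj_on (\<lambda>k. t Bundle [q', k]) {1..a}"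
      using bij same(1) [of q'] pend by (cases "q' = q") (auto simp: bij_betw_def pending_def)
  qed
  have 5: "\<forall>q'\<in>insert q P. \<exists>b. b \<noteq> a \<and> (\<forall>j\<in>bundle_jobs t q'. p j = b)"
  proof
    fix q' assume q': "q' \<in> insert q P"
    show "\<exists>b. b \<noteq> a \<and> (\<forall>j\<in>bundle_jobs t q'. p j = b)"
    proof (cases "q' = q")
      case True
      then show ?thesis using X(3,4) by (simp only: bq) blast
    next
      case False
      then have "q' \<in> P" using q' by simp
      moreover have "\<forall>q'\<in>P. \<exists>b. b \<noteq> a \<and> (\<forall>j\<in>bundle_jobs s q'. p j = b)"
        using pend unfolding pending_def by (elim conjE)
      ultimately show ?thesis by (simp only: bP)
    qed
  qed
  show ?thesis using pend 1 2 3 4 5 same unfolding pending_def by simp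
qed

lemma pending_take:
  assumes pend: "pending s P R" and r: "r < s NumB []" and q: "q = s Pend [r]"
    and asg: "\<And>j. t Asg [j] = (if j \<in> bundle_jobs s q then i else s Asg [j])" "i \<noteq> 0"
    and same: "t Bundle = s Bundle" "t RemA = s RemA" "t NumA = s NumA"
    and new: "t Pend = (s Pend)([r] := s Pend [s NumB [] - 1])" "t NumB [] = s NumB [] - 1"
  shows "q \<in> P" "pending t (P - {q}) R"
proof -
  have st: "stack (\<lambda>r. s Pend [r]) (s NumB []) P" using pend by (simp add: pending_def)
  show qP: "q \<in> P" using stack_take [OF st r] q by simp
  have 1: "stack (\<lambda>r. t Pend [r]) (t NumB []) (P - {q})"
    using stack_take(2) [OF st r] q new by (simp cong: if_cong)
  have un: "R \<union> (\<Union>q\<in>P. bundle_jobs s q) = {j \<in> {1..n}. s Asg [j] = 0}"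
    using pend by (simp add: pending_def)
  have "\<forall>j\<in>R. p j = a" and "\<exists>b. b \<noteq> a \<and> (\<forall>j\<in>bundle_jobs s q. p j = b)"
    using pend qP unfolding pending_def by blast+
  \<comment> \<open>The value of a bundle differs from \<open>a\<close>, so reassigning it takes
    nothing out of \<open>R\<close>.\<close>
  then have "R \<inter> bundle_jobs s q = {}" by force
  moreover have "bundle_jobs s q' \<inter> bundle_jobs s q = {}" if "q' \<in> P - {q}" for q'
    using pend qP that unfolding pending_def disjoint_family_on_def by blast
  ultimately have "R \<union> (\<Union>q'\<in>P - {q}. bundle_jobs s q') = (R \<union> (\<Union>q\<in>P. bundle_jobs s q)) - bundle_jobs s q"
    using qP by blast
  also have "\<dots> = {j \<in> {1..n}. t Asg [j] = 0}"
    unfolding un asg using asg(2) by auto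
  finally have 2: "R \<union> (\<Union>q'\<in>P - {q}. bundle_jobs s q') = {j \<in> {1..n}. t Asg [j] = 0}" .
  have 3: "disjoint_family_on (bundle_jobs s) (P - {q})"
    using pend by (auto simp: pending_def intro: disjoint_family_on_mono)
  show "pending t (P - {q}) R"
    using pend 1 2 3 unfolding pending_def same by simp
qed

subsection \<open>The three phases\<close>

definition loads_bounded :: "(nat \<Rightarrow> nat) \<Rightarrow> bool" where
  "loads_bounded f \<longleftrightarrow> (\<forall>i\<in>B. load f i \<le> T i)"

lemma loads_bounded_assign:
  assumes f: "loads_bounded f" and X: "X \<subseteq> {1..n}" "\<And>j. j \<in> X \<Longrightarrow> f j = 0"
    and i: "i \<in> B" "load f i + sum p X \<le> T i"
  shows "loads_bounded (\<lambda>j. if j \<in> X then i else f j)"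
proof -
  have "load (\<lambda>j. if j \<in> X then i else f j) k \<le> T k" if k: "k \<in> B" for k
  proof (cases "k = i")
    case True
    have "load (\<lambda>j. if j \<in> X then i else f j) i = load f i + sum p X"
      using X i by (intro load_assign) (auto simp: B_iff)
    then show ?thesis using True i by simp
  next
    case False
    have "load (\<lambda>j. if j \<in> X then i else f j) k = load f k"
      using False X k by (intro load_assign_other) (auto simp: B_iff)
    then show ?thesis using f k by (simp add: loads_bounded_def)
  qed
  then show ?thesis by (simp add: loads_bounded_def)
qed

text \<open>With no big machine the inequality is trivial, so the second conjunct secures that a
  pending bundle has somewhere to go. It is maintained because bundles are only taken from big
  machines.\<close>

definition spare_jobs :: "nat set \<Rightarrow> nat set \<Rightarrow> bool" where
  "spare_jobs P R \<longleftrightarrow> pm\<^sup>2 * card B \<le> card R \<and> (P \<noteq> {} \<longrightarrow> B \<noteq> {})"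

definition groups_listed :: "state \<Rightarrow> bool" where
  "groups_listed t \<longleftrightarrow> (\<forall>r<t NumC []. crowded (asg t) (t CandM [r]) (t CandB [r])) \<and>
     ((\<exists>i b. crowded (asg t) i b) \<longrightarrow> 0 < t NumC [])"

text \<open>No upper bound on loads appears, since targets may be exceeded before the last group is
  gone. The pending numbers form an initial segment, which makes \<open>NumB\<close> a fresh number
  for the next bundle.\<close>

definition removing :: "state \<Rightarrow> bool" where
  "removing t \<longleftrightarrow> ready t \<and> consistent (asg t) \<and>
     (\<forall>j\<in>{1..n}. asg t j \<in> B \<longrightarrow> p j \<noteq> a) \<and>
     (\<exists>R. pending t {..<t NumB []} R \<and> spare_jobs {..<t NumB []} R)"

lemma removing_find_groups:
  assumes "removing s"
  shows "wp n find_groups (\<lambda>t. removing t \<and> groups_listed t \<and> t Asg = s Asg) s"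
proof (rule wp_conseq [OF wp_find_groups])
  show "ready s" using assms by (simp add: removing_def)
next
  fix t
  assume t: "(\<forall>r<t NumC []. crowded (asg s) (t CandM [r]) (t CandB [r])) \<and>
    ((\<exists>i b. crowded (asg s) i b) \<longrightarrow> 0 < t NumC [])" and ag: "agree (mods find_groups) t s"
  have same: "t Asg = s Asg" "t NumB = s NumB" using ag by (simp_all add: agree_def find_groups_def)
  have "ready t"
    using conjunct1 [OF assms [unfolded removing_def]] ag
    by (rule ready_agree) (simp add: find_groups_def)
  moreover have "pending t P R" if "pending s P R" for P R
    using that ag by (rule pending_agree) (simp add: find_groups_def)
  ultimately show "removing t \<and> groups_listed t \<and> t Asg = s Asg"
    using assms t same unfolding removing_def groups_listed_def by (simp only:) blast
qed simp

lemma removing_bundle: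
  assumes s: "removing s" and cr: "crowded (asg s) (s Mach []) (s Val [])"
  shows "wp n remove_bundle (\<lambda>t. removing t \<and>
    card {j \<in> {1..n}. asg t j \<noteq> 0} < card {j \<in> {1..n}. asg s j \<noteq> 0}) s"
proof -
  let ?C = "{j \<in> {1..n}. s Asg [j] = s Mach [] \<and> p j = s Val []}" and ?q = "s NumB []"
  have i: "s Mach [] \<in> B" "s Val [] \<noteq> a" "a \<le> card ?C" using cr by (simp_all add: crowded_def)
  have rs: "ready s" using s by (simp add: removing_def)
  show ?thesis
  proof (rule wp_conseq [OF wp_remove_bundle [OF rs refl i(3) refl]])
    fix t
    assume "\<exists>X. X \<subseteq> ?C \<and> card X = a \<and> (\<forall>j. t Asg [j] = (if j \<in> X then 0 else s Asg [j])) \<and>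
         bij_betw (\<lambda>k. t Bundle [?q, k]) {1..a} X \<and>
         (\<forall>q' k. q' \<noteq> ?q \<longrightarrow> t Bundle [q', k] = s Bundle [q', k]) \<and>
         t Pend = (s Pend)([?q] := ?q) \<and> t NumB [] = Suc ?q"
      and ag: "agree (mods remove_bundle) t s"
    then obtain X where X: "X \<subseteq> ?C" "card X = a"
      and asg: "\<And>j. t Asg [j] = (if j \<in> X then 0 else s Asg [j])"
      and t: "bij_betw (\<lambda>k. t Bundle [?q, k]) {1..a} X"
         "\<And>q' k. q' \<noteq> ?q \<Longrightarrow> t Bundle [q', k] = s Bundle [q', k]"
         "t Pend = (s Pend)([?q] := ?q)" "t NumB [] = Suc ?q" by blast
    have Xs: "j \<in> {1..n}" "s Asg [j] = s Mach []" "p j = s Val []" "s Asg [j] \<noteq> 0" if "j \<in> X" for j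
      using X(1) i(1) that by (auto simp: B_iff)
    have "t RemA = s RemA" "t NumA = s NumA" using ag by (simp_all add: agree_def remove_bundle_def)
    then have push: "pending t {..<t NumB []} R" if "pending s {..<?q} R" for R
      using pending_push [OF that _ refl _ Xs(4) Xs(3) i(2) asg t(1,2) _ _ t(3,4)] Xs(1) t(4)
      by (simp add: lessThan_Suc subset_iff)
    have "a dvd (\<Sum>j | j \<in> X \<and> asg s j = k. p j)" for k
    proof (cases "k = s Mach []")
      case True
      then have "{j. j \<in> X \<and> asg s j = k} = X" using Xs by auto
      then show ?thesis using Xs(3) X(2) by simp
    next
      case False
      then have "{j. j \<in> X \<and> asg s j = k} = {}" using Xs by auto
      then show ?thesis by (simp only: sum.empty dvd_0_right)
    qed
    then have "consistent (asg t)"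
      unfolding asg using s Xs i by (intro consistent_remove) (auto simp: removing_def)
    moreover have "ready t"
      using rs ag by (rule ready_agree) (simp add: remove_bundle_def)
    moreover have "0 \<notin> B" by (simp add: B_iff)
    then have "\<forall>j\<in>{1..n}. asg t j \<in> B \<longrightarrow> p j \<noteq> a"
      using s by (simp add: removing_def asg)
    moreover obtain R where R: "pending s {..<?q} R" "spare_jobs {..<?q} R"
      using s unfolding removing_def by (elim conjE exE)
    \<comment> \<open>The bundle came from a machine in \<open>B\<close>, so \<open>B\<close> is
      nonempty even if nothing was pending before.\<close>
    have "spare_jobs {..<t NumB []} R"
      using R(2) i(1) unfolding spare_jobs_def by blast
    with push [OF R(1)] have "\<exists>R. pending t {..<t NumB []} R \<and> spare_jobs {..<t NumB []} R" by blast
    ultimately have "removing t" unfolding removing_def by (intro conjI)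
    moreover have "card {j \<in> {1..n}. asg t j \<noteq> 0} < card {j \<in> {1..n}. asg s j \<noteq> 0}"
    proof (rule psubset_card_mono)
      obtain j where "j \<in> X" using X(2) a_pos by fastforce
      then have "j \<in> {j \<in> {1..n}. asg s j \<noteq> 0}" "j \<notin> {j \<in> {1..n}. asg t j \<noteq> 0}"
        using Xs [of j] asg by auto
      moreover have "{j \<in> {1..n}. asg t j \<noteq> 0} \<subseteq> {j \<in> {1..n}. asg s j \<noteq> 0}"
        using asg by auto
      ultimately show "{j \<in> {1..n}. asg t j \<noteq> 0} \<subset> {j \<in> {1..n}. asg s j \<noteq> 0}" by blast
    qed simp
    ultimately show "removing t \<and>
        card {j \<in> {1..n}. asg t j \<noteq> 0} < card {j \<in> {1..n}. asg s j \<noteq> 0}" ..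
  qed
qed

text \<open>Bundles leave in arbitrary order, so the pending numbers no longer form an initial
  segment and \<open>P\<close> is quantified.\<close>

definition refilling :: "state \<Rightarrow> bool" where
  "refilling t \<longleftrightarrow> ready t \<and> consistent (asg t) \<and> loads_bounded (asg t) \<and>
     (\<exists>P R. pending t P R \<and> spare_jobs P R)"

lemma removing_agree:
  assumes "removing s" "agree X t s"
    "X \<inter> {NJobs, NMachines, PTime, Target, AVal, Thresh, Asg, RemA, NumA, Pend, NumB, Bundle} = {}"
  shows "removing t"
proof -
  have "t Asg = s Asg" "t NumB = s NumB" using assms(2,3) by (auto simp: agree_def)
  moreover have "ready t"
    using conjunct1 [OF assms(1) [unfolded removing_def]] assms(2)
    by (rule ready_agree) (use assms(3) in blast)
  moreover have "pending t P R" if "pending s P R" for P R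
    using that assms(2) by (rule pending_agree) (use assms(3) in auto)
  ultimately show ?thesis using assms(1) unfolding removing_def by (simp only:) blast
qed

lemma pendingD:
  assumes "pending s P R"
  shows "stack (\<lambda>r. s RemA [r]) (s NumA []) R" "stack (\<lambda>r. s Pend [r]) (s NumB []) P"
    "R \<union> (\<Union>q\<in>P. bundle_jobs s q) = {j \<in> {1..n}. s Asg [j] = 0}" "\<forall>j\<in>R. p j = a"
    "\<forall>q\<in>P. inj_on (\<lambda>k. s Bundle [q, k]) {1..a}" "disjoint_family_on (bundle_jobs s) P"
    "\<forall>q\<in>P. \<exists>b. b \<noteq> a \<and> (\<forall>j\<in>bundle_jobs s q. p j = b)"
  using assms [unfolded pending_def] by - (elim conjE, assumption)+

text \<open>A bundle consists of \<open>a\<close> distinct jobs of one common time \<open>b\<close>,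
  so it weighs \<open>a * b\<close>, with both factors at most \<open>pm\<close>; its size also
  yields \<open>a\<close> \<le> \<open>n\<close>.\<close>

lemma bundle_weight:
  assumes "pending s P R" "q \<in> P"
  shows "a dvd sum p (bundle_jobs s q)" "sum p (bundle_jobs s q) \<le> pm\<^sup>2"
    "(\<Sum>k=1..a. p (s Bundle [q, k])) = sum p (bundle_jobs s q)"
    "bundle_jobs s q \<subseteq> {1..n}" "\<And>j. j \<in> bundle_jobs s q \<Longrightarrow> s Asg [j] = 0" "a \<le> n"
proof -
  have inj: "inj_on (\<lambda>k. s Bundle [q, k]) {1..a}"
    by (rule pendingD(5) [OF assms(1), THEN bspec, OF assms(2)])
  obtain b where b: "\<And>j. j \<in> bundle_jobs s q \<Longrightarrow> p j = b"
    using pendingD(7) [OF assms(1), THEN bspec, OF assms(2)] by (elim exE conjE) (rule that, erule bspec)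
  have sub: "bundle_jobs s q \<subseteq> {j \<in> {1..n}. s Asg [j] = 0}"
    unfolding pendingD(3) [OF assms(1), symmetric] by (rule le_supI2) (rule UN_upper [OF assms(2)])
  show sub1: "bundle_jobs s q \<subseteq> {1..n}"
    using sub by (rule order_trans) (rule Collect_restrict)
  show "s Asg [j] = 0" if "j \<in> bundle_jobs s q" for j
    using subsetD [OF sub that] by simp
  have card: "card (bundle_jobs s q) = a" using inj by (simp add: card_image)
  then show "a \<le> n" using card_mono [OF _ sub1] by simp
  have sum: "sum p (bundle_jobs s q) = a * b" by (simp only: sum_const_card [OF b] card)
  then show "a dvd sum p (bundle_jobs s q)" by simp
  have "1 \<in> {1..a}" using a_pos by simp
  then have mem: "s Bundle [q, 1] \<in> bundle_jobs s q" by (rule imageI)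
  then have "p (s Bundle [q, 1]) \<le> pm" by (intro p_le) (rule subsetD [OF sub1])
  then have "b \<le> pm" by (simp only: b [OF mem])
  then show "sum p (bundle_jobs s q) \<le> pm\<^sup>2"
    unfolding sum power2_eq_square by (intro mult_mono a_le) simp_all
  show "(\<Sum>k=1..a. p (s Bundle [q, k])) = sum p (bundle_jobs s q)"
    by (simp only: sum.reindex [OF inj] o_def)
qed

lemma wp_phase_I:
  assumes s: "ready s" and start: "\<forall>i\<in>{1..m}. \<forall>j\<in>{1..n}. x i j = 1 \<longrightarrow> s Asg [j] = i"
  shows "wp n phase_I refilling s"
proof -
  have f: "consistent (asg s)" "\<And>j. j \<in> {1..n} \<Longrightarrow> s Asg [j] \<in> {1..m}"
    "pm\<^sup>2 * card B \<le> card {j \<in> {1..n}. p j = a \<and> s Asg [j] \<in> B}"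
    using start_consistent [of "asg s"] start by blast+
  let ?X = "{j \<in> {1..n}. p j = a \<and> s Asg [j] \<in> B}"
  let ?\<mu> = "\<lambda>t. card {j \<in> {1..n}. asg t j \<noteq> 0}"
  show ?thesis
    unfolding phase_I_def wp_simps
  proof (rule wp_conseq [OF wp_remove_a_jobs [OF s f(2) refl]])
    fix t
    assume t: "(\<forall>j. t Asg [j] = (if j \<in> ?X then 0 else s Asg [j])) \<and>
         stack (\<lambda>r. t RemA [r]) (t NumA []) ?X"
      and ag: "agree (mods remove_a_jobs) t s"
    let ?t = "upd NumB [] 0 t"
    have asg: "asg ?t = (\<lambda>j. if j \<in> ?X then 0 else s Asg [j])" using t by (simp add: upd_simps)
    \<comment> \<open>Every summand equals \<open>a\<close>.\<close>
    have "a dvd (\<Sum>j | j \<in> ?X \<and> asg s j = i. p j)" for i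
      by (rule dvd_sum) auto
    then have "consistent (asg ?t)"
      unfolding asg using f(1) by (intro consistent_remove) auto
    moreover have "ready ?t"
      using s by (rule ready_agree [of s "insert NumB (mods remove_a_jobs)"])
        (use ag in \<open>auto simp: agree_def upd_def remove_a_jobs_def\<close>)
    moreover have "0 \<notin> B" by (simp add: B_iff)
    \<comment> \<open>Every job had a machine at the start, so the unassigned jobs are exactly those
      just removed.\<close>
    moreover have "{j \<in> {1..n}. ?t Asg [j] = 0} = ?X"
    proof -
      have nz: "s Asg [j] \<noteq> 0" if "Suc 0 \<le> j" "j \<le> n" for j using f(2) [of j] that by auto
      then show ?thesis by (auto simp: fun_cong [OF asg] nz)
    qed
    then have "pending ?t {} ?X"
      using t unfolding pending_def by (auto simp: upd_simps stack_empty disjoint_family_on_def)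
    moreover have "\<forall>j\<in>{1..n}. asg ?t j \<in> B \<longrightarrow> p j \<noteq> a"
      using \<open>0 \<notin> B\<close> by (auto simp: fun_cong [OF asg])
    moreover have "{..<?t NumB []} = {}" by (simp add: upd_simps)
    moreover have "spare_jobs {} ?X" using f(3) by (simp add: spare_jobs_def)
    ultimately have "removing ?t"
      unfolding removing_def by (intro conjI exI [of _ ?X]) (simp_all only:)
    then show "wp n find_groups (wp n (WHILE Num 0 [<] Var NumC DO
       (Pick Rx (Var NumC) ;;
        Mach [:=] Get CandM [Var Rx] ;;
        Val [:=] Get CandB [Var Rx] ;;
        remove_bundle ;;
        find_groups)) refilling) (upd NumB (map (aval t) []) (aval t (Num 0)) t)"
      unfolding aval.simps list.map
    proof (rule wp_conseq [OF removing_find_groups])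
      fix u assume u: "removing u \<and> groups_listed u \<and> u Asg = ?t Asg"
      show "wp n (WHILE Num 0 [<] Var NumC DO
         (Pick Rx (Var NumC) ;;
          Mach [:=] Get CandM [Var Rx] ;;
          Val [:=] Get CandB [Var Rx] ;;
          remove_bundle ;;
          find_groups)) refilling u"
      proof (rule wp_while [where I = "\<lambda>u. removing u \<and> groups_listed u" and \<mu> = ?\<mu>])
        show "removing u \<and> groups_listed u" using u by simp
        show "?\<mu> u \<le> n" using card_mono [OF finite_atLeastAtMost Collect_restrict, of 1 n "\<lambda>j. asg u j \<noteq> 0"] by simp
      next
        fix v assume v: "removing v \<and> groups_listed v" and b: "bval v (Num 0 [<] Var NumC)"
        have cr: "crowded (asg v) (v CandM [r]) (v CandB [r])" if "r < v NumC []" for r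
          using v that by (simp add: groups_listed_def)
        have "wp n remove_bundle (wp n find_groups (\<lambda>w. (removing w \<and> groups_listed w) \<and> ?\<mu> w < ?\<mu> v))
            (upd Val [] (v CandB [r]) (upd Mach [] (v CandM [r]) (upd Rx [] r v)))"
          (is "wp n _ _ ?v") if r: "r < v NumC []" for r
        proof (rule wp_conseq [OF removing_bundle])
          show "removing ?v"
            using v by (auto intro!: removing_agree [of v "{Val, Mach, Rx}"] simp: agree_def upd_def)
          show "crowded (asg ?v) (?v Mach []) (?v Val [])"
            using cr [OF r] by (simp add: upd_simps)
        next
          fix w assume w: "removing w \<and> ?\<mu> w < ?\<mu> ?v"
          show "wp n find_groups (\<lambda>w. (removing w \<and> groups_listed w) \<and> ?\<mu> w < ?\<mu> v) w"
            by (rule wp_mono [OF removing_find_groups]) (use w in \<open>auto simp: upd_simps\<close>)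
        qed
        \<comment> \<open>A listed pair is crowded, and a crowded pair has at least
          \<open>a > 0\<close> jobs, all assigned; the number of assigned jobs is therefore a valid
          variant.\<close>
        moreover have "0 < ?\<mu> v"
        proof -
          have c: "crowded (asg v) (v CandM [0]) (v CandB [0])" using cr b by simp
          then have "{j \<in> {1..n}. asg v j = v CandM [0] \<and> p j = v CandB [0]} \<noteq> {}"
            using a_pos unfolding crowded_def by (metis card.empty le_zero_eq not_gr_zero)
          moreover have "v CandM [0] \<noteq> 0" using c by (auto simp: crowded_def B_iff)
          ultimately have "{j \<in> {1..n}. asg v j \<noteq> 0} \<noteq> {}" by force
          then show ?thesis by (simp add: card_gt_0_iff del: One_nat_def)
        qed
        ultimately show "0 < ?\<mu> v \<and> wp n
         (Pick Rx (Var NumC) ;;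
          Mach [:=] Get CandM [Var Rx] ;;
          Val [:=] Get CandB [Var Rx] ;;
          remove_bundle ;;
          find_groups) (\<lambda>w. (removing w \<and> groups_listed w) \<and> ?\<mu> w < ?\<mu> v) v"
          using b by (simp add: upd_simps)
      next
        fix v assume v: "removing v \<and> groups_listed v" and b: "\<not> bval v (Num 0 [<] Var NumC)"
        then have none: "\<not> crowded (asg v) i b" for i b by (auto simp: groups_listed_def)
        have "load (asg v) i \<le> T i" if "i \<in> B" for i
        proof (rule load_le_target [OF that])
          show "p j \<noteq> a" if "j \<in> {1..n}" "asg v j = i" for j
            using v that \<open>i \<in> B\<close> by (auto simp: removing_def)
          show "card {j \<in> {1..n}. asg v j = i \<and> p j = b} < a" if "b \<noteq> a" for b
            using none [of i b] that \<open>i \<in> B\<close> by (simp add: crowded_def)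
        qed
        then show "refilling v"
          using v by (auto simp: removing_def refilling_def loads_bounded_def)
      qed
    qed
  qed
qed

lemma choose_machine_load:
  assumes s: "ready s" and f: "asg s = f" and ex: "\<exists>i\<in>B. load f i + s Wt [] \<le> T i"
    and Q: "\<And>t. t Mach [] \<in> B \<Longrightarrow> load f (t Mach []) + s Wt [] \<le> T (t Mach []) \<Longrightarrow>
      agree {NumC, Ix, Load, Jx, CandM, Rx, Mach} t s \<Longrightarrow> Q t"
  shows "wp n choose_machine Q s"
proof (rule wp_conseq [OF wp_choose_machine [OF s _ ex]])
  show "s Asg [j] = f j" for j using f by auto
  fix t assume "t Mach [] \<in> B \<and> load f (t Mach []) + s Wt [] \<le> T (t Mach [])"
    "agree (mods choose_machine) t s"
  then show "Q t" by (intro Q) (simp_all add: choose_machine_def agree_def)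
qed

lemma wp_phase_II:
  assumes s: "refilling s"
  shows "wp n phase_II (\<lambda>t. refilling t \<and> t NumB [] = 0) s"
  unfolding phase_II_def
proof (rule wp_while [where I = refilling and \<mu> = "\<lambda>t. t NumB []"])
  show "refilling s" by (rule s)
  obtain P R where "pending s P R" using s unfolding refilling_def by (elim conjE exE)
  then show "s NumB [] \<le> n" by (rule pending_card)
next
  fix t assume "refilling t" "\<not> bval t (Num 0 [<] Var NumB)"
  then show "refilling t \<and> t NumB [] = 0" by simp
next
  fix s assume s: "refilling s" and b: "bval s (Num 0 [<] Var NumB)"
  obtain P R where PR: "pending s P R" "spare_jobs P R"
    and rs: "ready s" and cs: "consistent (asg s)" and ls: "loads_bounded (asg s)"
    using s unfolding refilling_def by (elim conjE exE)
  show "0 < s NumB [] \<and> wp n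
      (Pick Rx (Var NumB) ;;
        Qx [:=] Get Pend [Var Rx] ;;
        NumB [:=] Var NumB [-] Num 1 ;;
        Store Pend [Var Rx] (Get Pend [Var NumB]) ;;
        Wt [:=] Num 0 ;;
        FOR Kx UPTO Var AVal DO (Wt [:=] Var Wt [+] Get PTime [Get Bundle [Var Qx, Var Kx]]) ;;
        choose_machine ;;
        FOR Kx UPTO Var AVal DO (Store Asg [Get Bundle [Var Qx, Var Kx]] (Var Mach)))
      (\<lambda>t. refilling t \<and> t NumB [] < s NumB []) s"
    unfolding wp_simps
  proof (intro conjI allI impI, goal_cases)
    case 1
    then show ?case using b by simp
  next
    case 2
    then show ?case using b by simp
  next
    case (3 r)
    then have r: "r < s NumB []" by simp
    define q where "q = s Pend [r]"
    have qP: "q \<in> P" unfolding q_def by (rule stack_take(1) [OF pendingD(2) [OF PR(1)] r])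
    define X where "X = bundle_jobs s q"
    note w = bundle_weight [OF PR(1) qP, folded X_def]
    let ?Jw = "\<lambda>k t. t Wt [] = (\<Sum>l=1..k. p (s Bundle [q, l]))"
    show ?case
    proof (rule wp_for [where K = a and J = ?Jw], goal_cases)
      case (7 k t)
      have "t PTime [j] = p j" "t Bundle = s Bundle" "t Qx [] = q" for j
        using 7(4) rs by (simp_all add: agree_def upd_simps ready_def has_input_def q_def)
      then show ?case using 7(2,3) by (simp add: upd_simps)
    next
      case (8 t)
      have t: "t Asg = s Asg" "t Bundle = s Bundle" "t Qx [] = q" "t RemA = s RemA"
        "t NumA = s NumA" "t NumB [] = s NumB [] - 1"
        "t Pend = (s Pend)([r] := s Pend [s NumB [] - 1])"
        using 8(2) by (simp_all add: agree_def upd_simps q_def fun_upd_def)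
      have wt: "t Wt [] = sum p X" using 8(1) w(3) by simp
      have rt: "ready t"
        using rs 8(2) by (simp add: agree_def upd_simps ready_def has_input_def)
      have Rs: "j \<in> {1..n} \<and> asg s j = 0 \<and> p j = a" if "j \<in> R" for j
        using pendingD(3,4) [OF PR(1)] that by blast
      \<comment> \<open>All of \<open>R\<close> is still unassigned, so the averaging argument
        applies afresh to each bundle.\<close>
      have "\<exists>i\<in>B. load (asg s) i + sum p X \<le> T i"
        by (rule exists_machine_for_bundle [OF cs Rs])
          (use PR(2) qP w(2) in \<open>auto simp: spare_jobs_def\<close>)
      then have ex: "\<exists>i\<in>B. load (asg s) i + t Wt [] \<le> T i" by (simp only: wt)
      show ?case
      proof (rule choose_machine_load [OF rt _ ex], goal_cases)
        case 1
        show ?case by (simp add: t)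
      next
        case (2 u)
        note i = 2(1,2) and ag = 2(3)
        let ?i = "u Mach []"
        have u: "u Asg = s Asg" "u Bundle = s Bundle" "u Qx [] = q" "u RemA = s RemA"
          "u NumA = s NumA" "u NumB [] = s NumB [] - 1" "u AVal [] = a"
          "u Pend = (s Pend)([r] := s Pend [s NumB [] - 1])"
          using ag t rt by (simp_all add: agree_def ready_def has_input_def)
        have ru: "ready u" using rt ag by (rule ready_agree) simp
        let ?Ja = "\<lambda>k v. \<forall>j. v Asg [j] =
          (if j \<in> (\<lambda>l. s Bundle [q, l]) ` {1..k} then ?i else s Asg [j])"
        show ?case
        proof (rule wp_for [where K = a and J = ?Ja], goal_cases)
          case (7 k v)
          have "v Bundle = s Bundle" "v Qx [] = q" "v Mach [] = ?i"
            using 7(4) u by (simp_all add: agree_def upd_simps)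
          moreover have "(\<lambda>l. s Bundle [q, l]) ` {1..Suc k} =
              insert (s Bundle [q, Suc k]) ((\<lambda>l. s Bundle [q, l]) ` {1..k})"
            using atLeastAtMostSuc_conv [of 1 k] by (simp only: image_insert)
          ultimately show ?case using 7(2,3) by (simp add: upd_simps)
        next
          case (8 v)
          have v: "v Bundle = s Bundle" "v RemA = s RemA" "v NumA = s NumA"
            "v NumB [] = s NumB [] - 1" "v Pend = (s Pend)([r] := s Pend [s NumB [] - 1])"
            using 8(2) u by (simp_all add: agree_def upd_simps fun_upd_def)
          have asg: "v Asg [j] = (if j \<in> X then ?i else s Asg [j])" for j
            using 8(1) unfolding X_def by (rule spec)
          have asgv: "asg v = (\<lambda>j. if j \<in> X then ?i else asg s j)" by (simp add: asg)
          have "consistent (asg v)"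
            unfolding asgv by (rule consistent_assign [OF cs w(4) w(5) i(1) w(1)])
          moreover have "loads_bounded (asg v)"
            unfolding asgv
            by (rule loads_bounded_assign [OF ls w(4) w(5) i(1)]) (use i(2) wt in simp_all)
          moreover have "ready v"
            using ru 8(2) by (simp add: agree_def upd_simps ready_def has_input_def)
          moreover have "pending v (P - {q}) R"
            using i(1) by (intro pending_take(2) [OF PR(1) r q_def asg [unfolded X_def] _ v(1-3) v(5,4)])
              (simp add: B_iff)
          moreover have "spare_jobs (P - {q}) R" using PR(2) qP by (auto simp: spare_jobs_def)
          ultimately have "refilling v" unfolding refilling_def by blast
          then show ?case using r v(4) by simp
        qed (use u w(6) in \<open>simp_all add: agree_def upd_simps\<close>)
      qed
    qed (use w(6) rs in \<open>simp_all add: agree_def upd_simps ready_def has_input_def\<close>)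
  qed
qed

text \<open>The lower bound on the stock is gone, because these jobs now leave one at a time. In
  exchange \<open>R\<close> is the whole set of unassigned jobs, so emptying it completes the
  assignment.\<close>

definition finishing :: "state \<Rightarrow> bool" where
  "finishing t \<longleftrightarrow> ready t \<and> consistent (asg t) \<and> loads_bounded (asg t) \<and>
     (\<exists>R. stack (\<lambda>r. t RemA [r]) (t NumA []) R \<and> R = {j \<in> {1..n}. asg t j = 0} \<and> (\<forall>j\<in>R. p j = a))"

lemma refilling_finishing:
  assumes "refilling s" "s NumB [] = 0"
  shows "finishing s"
proof -
  obtain P R where PR: "pending s P R" and s: "ready s" "consistent (asg s)" "loads_bounded (asg s)"
    using assms(1) unfolding refilling_def by (elim conjE exE)
  have "P = {}" using pendingD(2) [OF PR] assms(2) by (simp add: stack_def)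
  then have "R = {j \<in> {1..n}. asg s j = 0}" using pendingD(3) [OF PR] by (simp only: UN_empty Un_empty_right)
  then show ?thesis using s pendingD(1,4) [OF PR] unfolding finishing_def by blast
qed

lemma wp_phase_III:
  assumes s: "finishing s"
  shows "wp n phase_III (\<lambda>t. finishing t \<and> t NumA [] = 0) s"
  unfolding phase_III_def
proof (rule wp_while [where I = finishing and \<mu> = "\<lambda>t. t NumA []"])
  show "finishing s" by (rule s)
  obtain R where R: "stack (\<lambda>r. s RemA [r]) (s NumA []) R" "R \<subseteq> {1..n}"
    using s unfolding finishing_def by blast
  then show "s NumA [] \<le> n" using card_mono [OF _ R(2)] stack_card [OF R(1)] by simp
next
  fix t assume "finishing t" "\<not> bval t (Num 0 [<] Var NumA)"
  then show "finishing t \<and> t NumA [] = 0" by simp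
next
  fix s assume s: "finishing s" and b: "bval s (Num 0 [<] Var NumA)"
  obtain R where R: "stack (\<lambda>r. s RemA [r]) (s NumA []) R" "R = {j \<in> {1..n}. asg s j = 0}"
      "\<forall>j\<in>R. p j = a"
    and rs: "ready s" and cs: "consistent (asg s)" and ls: "loads_bounded (asg s)"
    using s unfolding finishing_def by (elim conjE exE)
  show "0 < s NumA [] \<and> wp n
      (Pick Rx (Var NumA) ;;
        Job [:=] Get RemA [Var Rx] ;;
        NumA [:=] Var NumA [-] Num 1 ;;
        Store RemA [Var Rx] (Get RemA [Var NumA]) ;;
        Wt [:=] Get PTime [Var Job] ;;
        choose_machine ;;
        Store Asg [Var Job] (Var Mach))
      (\<lambda>t. finishing t \<and> t NumA [] < s NumA []) s"
    unfolding wp_simps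
  proof (intro conjI allI impI, goal_cases)
    case 1
    then show ?case using b by simp
  next
    case 2
    then show ?case using b by simp
  next
    case (3 r)
    then have r: "r < s NumA []" by simp
    define j where "j = s RemA [r]"
    have jR: "j \<in> R" and st: "stack (\<lambda>r'. if r' = r then s RemA [s NumA [] - Suc 0] else s RemA [r'])
        (s NumA [] - Suc 0) (R - {j})"
      unfolding j_def using stack_take [OF R(1) r] by blast+
    have j: "j \<in> {1..n}" "asg s j = 0" "p j = a" using jR R(2,3) by auto
    have "s PTime [j] = a" using rs j(3) by (simp add: ready_def has_input_def)
    note ex = exists_machine_for_job [OF cs _ j]
    show ?case
    proof (rule choose_machine_load [where f = "asg s"], goal_cases)
      case 1
      show ?case using rs by (simp add: upd_simps ready_def has_input_def)
    next
      case 2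
      show ?case by (simp add: upd_simps)
    next
      case 3
      show ?case
        using ex ls rs j by (simp add: upd_simps loads_bounded_def ready_def has_input_def j_def [symmetric])
    next
      case (4 u)
      let ?i = "u Mach []"
      have i: "?i \<in> B" "load (asg s) ?i + a \<le> T ?i"
        using 4(1,2) rs j by (simp_all add: upd_simps ready_def has_input_def j_def [symmetric])
      have u: "u Asg = s Asg" "u NumA [] = s NumA [] - 1" "u Job [] = j"
          "u RemA = (s RemA)([r] := s RemA [s NumA [] - 1])"
        using 4(3) by (simp_all add: agree_def upd_simps j_def fun_upd_def)
      have ru: "ready u"
        using rs 4(3) by (simp add: agree_def upd_simps ready_def has_input_def)
      let ?v = "upd Asg [j] ?i u"
      have asgv: "asg ?v = (\<lambda>j'. if j' \<in> {j} then ?i else asg s j')" using u by (auto simp: upd_simps)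
      have "consistent (asg ?v)"
        unfolding asgv using j by (intro consistent_assign [OF cs _ _ i(1)]) auto
      moreover have "loads_bounded (asg ?v)"
        unfolding asgv using j i(2) by (intro loads_bounded_assign [OF ls _ _ i(1)]) auto
      moreover have "ready ?v" using ru by (simp add: upd_simps ready_def has_input_def)
      moreover have "R - {j} = {j' \<in> {1..n}. asg ?v j' = 0}"
        unfolding R(2) using i(1) by (auto simp: fun_cong [OF asgv] B_iff)
      moreover have "stack (\<lambda>r. ?v RemA [r]) (?v NumA []) (R - {j})"
        using st u by (simp add: upd_simps cong: if_cong)
      ultimately have "finishing ?v" unfolding finishing_def using R(3) by blast
      then show ?case using r u by (simp add: upd_simps)
    qed
  qed
qed

section \<open>Feasibility of the output and composition of the phases\<close>

lemma finishing_feasible: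
  assumes s: "finishing s" "s NumA [] = 0"
  shows "feasible_partition n m p T (job_sets n s)"
proof -
  obtain R where R: "stack (\<lambda>r. s RemA [r]) (s NumA []) R" "R = {j \<in> {1..n}. asg s j = 0}"
    and cs: "consistent (asg s)" and ls: "loads_bounded (asg s)"
    using s(1) unfolding finishing_def by (elim conjE exE)
  have "R = {}" using R(1) s(2) by (simp add: stack_def)
  have all: "asg s j \<noteq> 0" if "j \<in> {1..n}" for j
  proof
    assume "asg s j = 0"
    then have "j \<in> R" unfolding R(2) using that by simp
    then show False using \<open>R = {}\<close> by simp
  qed
  have le: "load (asg s) i \<le> T i" if "i \<in> B" for i
    using ls that by (simp only: loads_bounded_def)
  have load: "sum p {j \<in> {1..n}. s Asg [j] = i} = T i" if "i \<in> {1..m}" for i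
    using all_targets_met [OF cs le all that] by (simp only: load_def)
  have "asg s j \<le> m" if "j \<in> {1..n}" for j
    using cs that unfolding consistent_def by (elim conjE) (rule bspec)
  then have "s Asg [j] \<in> {1..m}" if "j \<in> {1..n}" for j
    using all [OF that] that by (simp add: Suc_le_eq)
  then have "(\<Union>i\<in>{1..m}. {j \<in> {1..n}. s Asg [j] = i}) = {1..n}" by blast
  then show ?thesis
    unfolding feasible_partition_def job_sets_def by (intro conjI ballI impI load) auto
qed

lemma wp_procedure:
  "wp n procedure (\<lambda>s. feasible_partition n m p T (job_sets n s)) (input_state n m p T a x)"
  unfolding procedure_def wp_simps
proof (rule wp_mono [OF wp_start_assignment])
  show "has_input (input_state n m p T a x)"
    by (simp add: has_input_def input_state_def)
  show "input_state n m p T a x XSol [i, j] = x i j" for i j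
    by (simp add: input_state_def)
next
  fix s assume "ready s \<and> (\<forall>i\<in>{1..m}. \<forall>j\<in>{1..n}. x i j = 1 \<longrightarrow> s Asg [j] = i)"
  then show "wp n phase_I (wp n phase_II (wp n phase_III
      (\<lambda>s. feasible_partition n m p T (job_sets n s)))) s"
  proof (elim conjE, elim wp_mono [OF wp_phase_I])
    fix s assume "refilling s"
    then show "wp n phase_II (wp n phase_III
        (\<lambda>s. feasible_partition n m p T (job_sets n s))) s"
    proof (rule wp_mono [OF wp_phase_II], elim conjE)
      fix s assume "refilling s" "s NumB [] = 0"
      then have "finishing s" by (rule refilling_finishing)
      then show "wp n phase_III (\<lambda>s. feasible_partition n m p T (job_sets n s)) s"
        by (rule wp_mono [OF wp_phase_III]) (elim conjE, rule finishing_feasible)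
    qed
  qed
qed

end

theorem theorem3:
  "\<exists>q :: nat poly. \<forall>n m (p :: nat \<Rightarrow> nat) (T :: nat \<Rightarrow> nat) a (x :: nat \<Rightarrow> nat \<Rightarrow> nat).
     mp_instance n m p T \<and> a \<in> p ` {1..n} \<and> a > 0 \<and> mod_IP_feasible n m p T a x \<longrightarrow>
     (\<forall>t c s. (step ^^ t) (procedure, input_state n m p T a x) (c, s) \<longrightarrow>
        t \<le> poly q n \<and>
        (final (c, s) \<longrightarrow> c = Skip \<and> feasible_partition n m p T (job_sets n s)))"
proof -
  \<comment> \<open>The polynomial depends on the program text alone and is fixed before any
    instance is considered.\<close>
  obtain q where q: "\<And>n. cost n procedure = poly q n" using cost_poly by blast
  show ?thesis
  proof (intro exI [of _ q] allI impI)
    fix n m p T a x t c s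
    assume "mp_instance n m p T \<and> a \<in> p ` {1..n} \<and> a > 0 \<and> mod_IP_feasible n m p T a x"
      and run: "(step ^^ t) (procedure, input_state n m p T a x) (c, s)"
    then interpret mod_solution n m p T a x by unfold_locales auto
    show "t \<le> poly q n \<and>
        (final (c, s) \<longrightarrow> c = Skip \<and> feasible_partition n m p T (job_sets n s))"
      using runs_ok_sound [OF wp_sound [OF wp_procedure] run] unfolding q .
  qed
qed

end
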